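(* Suppose the following two convergence hypotheses hold: $$\lim_{h\to 0}\ \beta(h)^{-1}\inf_{w\in \mathcal S_{1,h}}\|v-w\|_{\mathcal V}=0\quad\text{for each } v\in\mathcal V,\qquad\text{and}\qquad \lim_{h\to 0}\delta_{\mathcal V}(T_h,T)=0 .$$ Then there exist $h_0>0$ and a constant $c>0$ such that for each $h<h_0$ and all $u\in\mathcal U$ with $\|u\|_{\mathcal V}=1$ there is a $u_h\in\mathcal U_h$ with $$\|u_h-P_hu\|_{\mathcal V}\le c\,\varepsilon_{\mathcal V}(h)\,\delta_{\mathcal V}(\mathcal U,\mathcal S_{1,h}),$$ where $c$ is independent of $h$ and independent of the choice of $u$.
   Context: Inner products and sesquilinear forms are conjugate linear in the first argument. $\mathcal H$ is a complex separable Hilbert space. $a(\cdot,\cdot)$ is a closed, densely defined, sectorial sesquilinear form in $\mathcal H$ with domain $\mathcal V=\mathrm{Dom}(a)$: for some fixed $\alpha,M>0$, $\mathrm{Re}\,a(v,v)\ge\alpha\|v\|_{\mathcal H}^2$ and $|\mathrm{Im}\,a(v,v)|\le M(\mathrm{Re}\,a(v,v)-\alpha\|v\|_{\mathcal H}^2)$ for all $v\in\mathcal V$. $\mathcal V$ is a Hilbert space under an inner product $\langle\cdot,\cdot\rangle_{\mathcal V}$ equivalent to $\frac12\big(a(w,v)+\overline{a(v,w)}\big)$. $A$ is the closed m-sectorial operator in $\mathcal H$ associated with $a$: $\mathrm{Dom}(A)=\{v\in\mathcal V: \exists\, m_v,\ |a(w,v)|\le m_v\|w\|_{\mathcal H}\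 \forall w\in\mathcal V\}$ and $a(w,v)=\langle w,Av\rangle_{\mathcal H}$ for $v\in \mathrm{Dom}(A)$, $w\in\mathcal V$. $T=A^{-1}$; equivalently, for $v\in\mathcal H$, $Tv\in\mathcal V$ is determined by $\langle u,v\rangle_{\mathcal H}=a(u,Tv)$ for all $u\in\mathcal V$. $T$ restricts to a bounded operator on $\mathcal V$. $\lambda\ne0$ is an isolated eigenvalue of $A$ of finite algebraic multiplicity $m$, and $\mathcal U=\bigcup_{k\ge1}\mathrm{Ker}[(A-\lambda I)^k]$ is the associated $m$-dimensional maximal invariant subspace (the range of the spectral projection); it is also the invariant subspace of $T$ for its isolated eigenvalue $\mu=1/\lambda$. For each $h>0$, $\mathcal S_{1,h},\mathcal S_{2,h}\subset\mathcal V$ are subspaces of the same finite dimension $N(h)$ satisfying $$\beta(h)=\inf_{u\in\mathcal S_{2,h},\|u\|_{\mathcal V}=1}\ \sup_{v\in\mathcal S_{1,h},\|v\|_{\mathcal V}=1}|a(u,v)|>0,\qquad \overset{\circ}{\beta}(h)=\inf_{u\in\mathcal S_{2,h},\|u\|_{\mathcal H}=1}\ \sup_{v\in\mathcal S_{1,h},\|v\|_{\mathcal H}=1}|\langle u,v\rangle_{\mathcal H}|>0.$$ $P_h:\mathcal V\to\mathcal S_{1,h}$ is the (generally oblique) projection defined by $a(u,v-P_hv)=0$ for all $u\in\mathcal S_{2,h}$. $T_h=P_hTP_h$. $\Pi_{1,h}$ is the $\mathcal V$-orthogonal projection onto $\mathcal S_{1,h}$. For closed subspaces $\mathcal M,\mathcal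 N$ of $\mathcal V$, $\delta_{\mathcal V}(\mathcal M,\mathcal N)=\sup_{0\ne x\in\mathcal M}\inf_{y\in\mathcal N}\|y-x\|_{\mathcal V}/\|x\|_{\mathcal V}$. For closed operators $L,B$ in $\mathcal V$, $\delta_{\mathcal V}(L,B)=\sup_{0\neq x\in \mathrm{Dom}(L)}\inf_{y\in \mathrm{Dom}(B)}\frac{\|x-y\|_{\mathcal V}+\|Lx-By\|_{\mathcal V}}{\|x\|_{\mathcal V}+\|Lx\|_{\mathcal V}}$. In $\delta_{\mathcal V}(T_h,T)$, $T$ is regarded as an operator on $\mathcal V$ and $\mathrm{Dom}(T_h)=\mathcal S_{1,h}$. Let $\Sigma$ be a circle in $\mathbb C$ centered at $\mu$ with the origin and all points of $\sigma(T)$ other than $\mu$ in its exterior. Under the two convergence hypotheses, for all sufficiently small $h$ exactly $m$ eigenvalues of $T_h$ (counting multiplicity) lie inside $\Sigma$ and none on $\Sigma$; $\mathcal U_h\subset\mathcal S_{1,h}$ denotes the $m$-dimensional $T_h$-invariant subspace associated with them, i.e. the range of $E_h=\frac1{2\pi i}\int_\Sigma(z-T_h)^{-1}dz$. Finally, $$\varepsilon_{\mathcal V}(h)=\sup_{u\in\mathcal U}\frac{\|P_hT(I-P_h)u\|_{\mathcal V}}{\|(I-\Pi_{1,h})u\|_{\mathcal V}},$$ where quotients $0/0$ are read as $0$ (the numerator vanishes whenever the denominator does). *)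

theory Defs
  imports "HOL-Complex_Analysis.Complex_Analysis"
begin

section \<open>Complex Hilbert spaces\<close>

text \<open>The norm is inherited from \<^class>\<open>banach\<close>. Positive definiteness of the inner product
  and the law \<open>1 *\<^sub>C x = x\<close> follow from the axioms that tie \<open>cinner\<close> to the norm and
  \<open>scaleC\<close> to the real scalar multiplication.\<close>

class chilbert_space = banach +
  fixes scaleC :: "complex \<Rightarrow> 'a \<Rightarrow> 'a"  (infixr "*\<^sub>C" 75)
    and cinner :: "'a \<Rightarrow> 'a \<Rightarrow> complex"
  assumes scaleC_add_right: "c *\<^sub>C (x + y) = c *\<^sub>C x + c *\<^sub>C y"
    and scaleC_add_left: "(c + d) *\<^sub>C x = c *\<^sub>C x + d *\<^sub>C x"
    and scaleC_scaleC: "c *\<^sub>C d *\<^sub>C x = (c * d) *\<^sub>C x"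
    and scaleR_scaleC: "r *\<^sub>R x = complex_of_real r *\<^sub>C x"
    and cinner_commute: "cinner x y = cnj (cinner y x)"
    and cinner_add_right: "cinner x (y + z) = cinner x y + cinner x z"
    and cinner_scaleC_right: "cinner x (c *\<^sub>C y) = c * cinner x y"
    and norm_eq_sqrt_cinner: "norm x = sqrt (Re (cinner x x))"

interpretation complex_vector: vector_space "scaleC :: complex \<Rightarrow> 'a \<Rightarrow> 'a::chilbert_space"
proof
  fix c d :: complex and x y :: 'a
  show "c *\<^sub>C (x + y) = c *\<^sub>C x + c *\<^sub>C y" by (rule scaleC_add_right)
  show "(c + d) *\<^sub>C x = c *\<^sub>C x + d *\<^sub>C x" by (rule scaleC_add_left)
  show "c *\<^sub>C d *\<^sub>C x = (c * d) *\<^sub>C x" by (rule scaleC_scaleC)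
  show "1 *\<^sub>C x = x" using scaleR_scaleC[of 1 x] by simp
qed

text \<open>Unlike \<open>complex_vector.dim S = n\<close>, this includes that \<open>S\<close> is a subspace and finite-dimensional.\<close>

definition has_cdim :: "'a::chilbert_space set \<Rightarrow> nat \<Rightarrow> bool" where
  "has_cdim S n \<longleftrightarrow>
     (\<exists>B. finite B \<and> card B = n \<and> complex_vector.independent B \<and> complex_vector.span B = S)"


section \<open>Forms and inner products on a subspace\<close>

definition sesquilinear_on :: "'a::chilbert_space set \<Rightarrow> ('a \<Rightarrow> 'a \<Rightarrow> complex) \<Rightarrow> bool" where
  "sesquilinear_on V s \<longleftrightarrow>
     (\<forall>x\<in>V. \<forall>y\<in>V. \<forall>z\<in>V. s (x + y) z = s x z + s y z \<and> s x (y + z) = s x y + s x z) \<and>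
     (\<forall>x\<in>V. \<forall>y\<in>V. \<forall>c. s (c *\<^sub>C x) y = cnj c * s x y \<and> s x (c *\<^sub>C y) = c * s x y)"

definition inner_product_on :: "'a::chilbert_space set \<Rightarrow> ('a \<Rightarrow> 'a \<Rightarrow> complex) \<Rightarrow> bool" where
  "inner_product_on V s \<longleftrightarrow>
     sesquilinear_on V s \<and> (\<forall>x\<in>V. \<forall>y\<in>V. s x y = cnj (s y x)) \<and>
     (\<forall>x\<in>V. x \<noteq> 0 \<longrightarrow> Re (s x x) > 0)"

definition ipnorm :: "('a \<Rightarrow> 'a \<Rightarrow> complex) \<Rightarrow> 'a \<Rightarrow> real" where
  "ipnorm s x = sqrt (Re (s x x))"

definition hilbert_on :: "'a::chilbert_space set \<Rightarrow> ('a \<Rightarrow> 'a \<Rightarrow> complex) \<Rightarrow> bool" where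
  "hilbert_on V s \<longleftrightarrow>
     complex_vector.subspace V \<and> inner_product_on V s \<and>
     (\<forall>x::nat \<Rightarrow> 'a. (\<forall>n. x n \<in> V) \<and>
        ((\<lambda>(i, j). ipnorm s (x i - x j)) \<longlongrightarrow> 0) (sequentially \<times>\<^sub>F sequentially) \<longrightarrow>
        (\<exists>l\<in>V. (\<lambda>n. ipnorm s (x n - l)) \<longlonglongrightarrow> 0))"

definition equivalent_ip_on ::
    "'a set \<Rightarrow> ('a \<Rightarrow> 'a \<Rightarrow> complex) \<Rightarrow> ('a \<Rightarrow> 'a \<Rightarrow> complex) \<Rightarrow> bool" where
  "equivalent_ip_on V s t \<longleftrightarrow>
     (\<exists>k>0. \<exists>K>0. \<forall>v\<in>V. k * ipnorm t v \<le> ipnorm s v \<and> ipnorm s v \<le> K * ipnorm t v)"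

definition form_real_part :: "('a \<Rightarrow> 'a \<Rightarrow> complex) \<Rightarrow> 'a \<Rightarrow> 'a \<Rightarrow> complex" where
  "form_real_part a w v = (a w v + cnj (a v w)) / 2"

text \<open>Closedness in Kato's sense.\<close>

definition closed_form_on :: "'a::chilbert_space set \<Rightarrow> ('a \<Rightarrow> 'a \<Rightarrow> complex) \<Rightarrow> bool" where
  "closed_form_on V a \<longleftrightarrow>
     (\<forall>(x::nat \<Rightarrow> 'a) l. (\<forall>n. x n \<in> V) \<and> x \<longlonglongrightarrow> l \<and>
        ((\<lambda>(i, j). a (x i - x j) (x i - x j)) \<longlongrightarrow> 0) (sequentially \<times>\<^sub>F sequentially) \<longrightarrow>
        l \<in> V \<and> (\<lambda>n. a (x n - l) (x n - l)) \<longlonglongrightarrow> 0)"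

definition closed_sectorial_form ::
    "'a::chilbert_space set \<Rightarrow> ('a \<Rightarrow> 'a \<Rightarrow> complex) \<Rightarrow> real \<Rightarrow> real \<Rightarrow> bool" where
  "closed_sectorial_form V a \<alpha> M \<longleftrightarrow>
     complex_vector.subspace V \<and> closure V = UNIV \<and> sesquilinear_on V a \<and> closed_form_on V a \<and>
     (\<forall>v\<in>V. Re (a v v) \<ge> \<alpha> * (norm v)\<^sup>2 \<and>
            \<bar>Im (a v v)\<bar> \<le> M * (Re (a v v) - \<alpha> * (norm v)\<^sup>2))"


section \<open>The operator associated with a form, and its inverse\<close>

definition form_dom :: "'a::chilbert_space set \<Rightarrow> ('a \<Rightarrow> 'a \<Rightarrow> complex) \<Rightarrow> 'a set" where
  "form_dom V a = {v\<in>V. \<exists>m. \<forall>w\<in>V. cmod (a w v) \<le> m * norm w}"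

definition form_op :: "'a::chilbert_space set \<Rightarrow> ('a \<Rightarrow> 'a \<Rightarrow> complex) \<Rightarrow> 'a \<Rightarrow> 'a" where
  "form_op V a v = (THE f. \<forall>w\<in>V. a w v = cinner w f)"

definition form_inv :: "'a::chilbert_space set \<Rightarrow> ('a \<Rightarrow> 'a \<Rightarrow> complex) \<Rightarrow> 'a \<Rightarrow> 'a" where
  "form_inv V a = the_inv_into (form_dom V a) (form_op V a)"


section \<open>Spectrum and spectral projections\<close>

text \<open>Spectrum of an operator \<open>L\<close> with domain \<open>D\<close> acting in the space \<open>W\<close>.\<close>

definition op_spectrum :: "'a::chilbert_space set \<Rightarrow> 'a set \<Rightarrow> ('a \<Rightarrow> 'a) \<Rightarrow> complex set" where
  "op_spectrum W D L =
     - {z. bij_betw (\<lambda>x. z *\<^sub>C x - L x) D W \<and>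
           (\<exists>K. \<forall>x\<in>D. norm x \<le> K * norm (z *\<^sub>C x - L x))}"

text \<open>The resolvent is \<open>(z - L)\<^sup>-\<^sup>1\<close>, with the sign used in the Riesz projection.\<close>

definition resolvent :: "'a::chilbert_space set \<Rightarrow> ('a \<Rightarrow> 'a) \<Rightarrow> complex \<Rightarrow> 'a \<Rightarrow> 'a" where
  "resolvent D L z = the_inv_into D (\<lambda>x. z *\<^sub>C x - L x)"

text \<open>Vector-valued analogue of \<^const>\<open>contour_integral\<close>.\<close>

definition vcontour_integral :: "(real \<Rightarrow> complex) \<Rightarrow> (complex \<Rightarrow> 'a::chilbert_space) \<Rightarrow> 'a" where
  "vcontour_integral g f = integral {0..1} (\<lambda>t. vector_derivative g (at t within {0..1}) *\<^sub>C f (g t))"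

definition riesz_projection ::
    "'a::chilbert_space set \<Rightarrow> ('a \<Rightarrow> 'a) \<Rightarrow> complex \<Rightarrow> real \<Rightarrow> 'a \<Rightarrow> 'a" where
  "riesz_projection D L c r v =
     (1 / (2 * of_real pi * \<i>)) *\<^sub>C vcontour_integral (circlepath c r) (\<lambda>z. resolvent D L z v)"

text \<open>Isolated eigenvalue of finite algebraic multiplicity \<open>m\<close> of an operator in the whole
  space; the algebraic multiplicity is the rank of the spectral projection, which does not depend
  on the isolating circle.\<close>

definition isolated_eigenvalue ::
    "'a::chilbert_space set \<Rightarrow> ('a \<Rightarrow> 'a) \<Rightarrow> complex \<Rightarrow> nat \<Rightarrow> bool" where
  "isolated_eigenvalue D L z m \<longleftrightarrow>
     (\<exists>v\<in>D. v \<noteq> 0 \<and> L v = z *\<^sub>C v) \<and> z isolated_in op_spectrum UNIV D L \<and>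
     (\<exists>\<rho>>0. cball z \<rho> \<inter> op_spectrum UNIV D L = {z} \<and>
            has_cdim (range (riesz_projection D L z \<rho>)) m)"

text \<open>\<open>Ker[(L - z)\<^sup>k]\<close>, including the domain condition for powers of an unbounded operator.\<close>

definition ker_power :: "'a::chilbert_space set \<Rightarrow> ('a \<Rightarrow> 'a) \<Rightarrow> complex \<Rightarrow> nat \<Rightarrow> 'a set" where
  "ker_power D L z k =
     {v. (\<forall>j<k. ((\<lambda>x. L x - z *\<^sub>C x) ^^ j) v \<in> D) \<and> ((\<lambda>x. L x - z *\<^sub>C x) ^^ k) v = 0}"

definition invariant_subspace :: "'a::chilbert_space set \<Rightarrow> ('a \<Rightarrow> 'a) \<Rightarrow> complex \<Rightarrow> 'a set" where
  "invariant_subspace D L z = (\<Union>k\<in>{1..}. ker_power D L z k)"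


section \<open>Gaps\<close>

text \<open>The suprema below and the infima and suprema of the next section are real-valued; they are
  only used where the index sets are nonempty and the families bounded.\<close>

definition set_dist :: "('a \<Rightarrow> real) \<Rightarrow> 'a::ab_group_add \<Rightarrow> 'a set \<Rightarrow> real" where
  "set_dist nrm v S = (INF w\<in>S. nrm (v - w))"

definition subspace_gap :: "('a \<Rightarrow> real) \<Rightarrow> 'a::ab_group_add set \<Rightarrow> 'a set \<Rightarrow> real" where
  "subspace_gap nrm M N = (SUP x\<in>M - {0}. INF y\<in>N. nrm (y - x) / nrm x)"

definition operator_gap ::
    "('a \<Rightarrow> real) \<Rightarrow> 'a::ab_group_add set \<Rightarrow> ('a \<Rightarrow> 'a) \<Rightarrow> 'a set \<Rightarrow> ('a \<Rightarrow> 'a) \<Rightarrow> real" where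
  "operator_gap nrm DL L DB B =
     (SUP x\<in>DL - {0}. INF y\<in>DB. (nrm (x - y) + nrm (L x - B y)) / (nrm x + nrm (L x)))"


section \<open>Petrov-Galerkin discretisation\<close>

text \<open>With \<open>s = a\<close> and the norm of \<open>V\<close> this is \<open>\<beta>\<close>; with \<open>s = cinner\<close> and the norm of the
  ambient space it is the ring-accented \<open>\<beta>\<close>.\<close>

definition inf_sup :: "('a \<Rightarrow> real) \<Rightarrow> ('a \<Rightarrow> 'a \<Rightarrow> complex) \<Rightarrow> 'a set \<Rightarrow> 'a set \<Rightarrow> real" where
  "inf_sup nrm s S1 S2 = (INF u\<in>{u\<in>S2. nrm u = 1}. SUP v\<in>{v\<in>S1. nrm v = 1}. cmod (s u v))"

text \<open>Projection onto \<open>S1\<close> along the right \<open>s\<close>-annihilator of \<open>S2\<close>; for an inner product \<open>s\<close> and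
  \<open>S1 = S2\<close> this is the \<open>s\<close>-orthogonal projection.\<close>

definition oblique_projection ::
    "('a \<Rightarrow> 'a \<Rightarrow> complex) \<Rightarrow> 'a::ab_group_add set \<Rightarrow> 'a set \<Rightarrow> 'a \<Rightarrow> 'a" where
  "oblique_projection s S1 S2 v = (THE p. p \<in> S1 \<and> (\<forall>u\<in>S2. s u (v - p) = 0))"

abbreviation orth_projection ::
    "('a \<Rightarrow> 'a \<Rightarrow> complex) \<Rightarrow> 'a::ab_group_add set \<Rightarrow> 'a \<Rightarrow> 'a" where
  "orth_projection s S \<equiv> oblique_projection s S S"

definition discrete_inv ::
    "'a::chilbert_space set \<Rightarrow> ('a \<Rightarrow> 'a \<Rightarrow> complex) \<Rightarrow> 'a set \<Rightarrow> 'a set \<Rightarrow> 'a \<Rightarrow> 'a" where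
  "discrete_inv V a S1 S2 =
     oblique_projection a S1 S2 \<circ> form_inv V a \<circ> oblique_projection a S1 S2"

text \<open>Quotients \<open>0/0\<close> are \<open>0\<close>, as intended, by \<open>x / 0 = 0\<close> in HOL.\<close>

definition eps_V ::
    "'a::chilbert_space set \<Rightarrow> ('a \<Rightarrow> 'a \<Rightarrow> complex) \<Rightarrow> ('a \<Rightarrow> 'a \<Rightarrow> complex)
      \<Rightarrow> 'a set \<Rightarrow> 'a set \<Rightarrow> 'a set \<Rightarrow> real" where
  "eps_V V a ip S1 S2 U =
     (SUP u\<in>U.
        ipnorm ip (oblique_projection a S1 S2 (form_inv V a (u - oblique_projection a S1 S2 u)))
        / ipnorm ip (u - orth_projection ip S1 u))"

end

theory Submission
  imports Defs
begin

text \<open>Write \<open>\<mu> = 1 / lam\<close>, let \<open>T\<close> be the inverse of the operator \<open>A\<close> of the form, \<open>P\<close> the oblique projection onto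
  \<open>S1\<close>, \<open>\<Pi>\<close> the orthogonal one, and \<open>Th = P T P\<close>. Given \<open>u \<in> U\<close>, the vector \<open>u_h\<close> is the discrete Riesz
  projection of \<open>P u\<close>.

  A vector \<open>u \<in> U\<close> is annihilated by a power \<open>(T - \<mu>)\<^sup>k\<close>, so for \<open>z \<noteq> \<mu>\<close> the equation \<open>(z - T) w = u\<close> has the
  explicit solution \<open>w(z) = (\<Sum>j<k. (z - \<mu>)\<^bsup>-j-1\<^esup> (T - \<mu>)\<^sup>j u) \<in> U\<close>, and integrating \<open>P w(z)\<close> over the circle gives
  \<open>2 \<pi> \<i> P u\<close> by Cauchy's formula for the powers of \<open>z - \<mu>\<close>. Since \<open>Th P = P T P\<close>, one has
  \<open>(z - Th) P w(z) = P u + P T (1 - P) w(z)\<close>; hence \<open>P w(z)\<close> and \<open>(z - Th)\<^sup>-\<^sup>1 P u\<close> differ by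
  \<open>(z - Th)\<^sup>-\<^sup>1 P T (1 - P) w(z)\<close>.
  By the definition of \<open>\<epsilon>\<^sub>V\<close> and of the gap, the norm of \<open>P T (1 - P) w(z)\<close> is at most
  \<open>\<epsilon>\<^sub>V \<parallel>(1 - \<Pi>) w(z)\<parallel> \<le> \<epsilon>\<^sub>V \<delta>(U, S1) \<parallel>w(z)\<parallel>\<close>. Integrating the difference over the circle yields the estimate
  (lemma \<open>eigenvector_estimate\<close>), provided that \<open>(z - T)\<^sup>-\<^sup>1\<close> on \<open>V\<close> and \<open>(z - Th)\<^sup>-\<^sup>1\<close> on \<open>S1\<close> are bounded
  uniformly for \<open>z\<close> on the circle and small \<open>h\<close>.

  The first bound (lemma \<open>resolvent_bound_nrm\<close>) comes from compactness of the circle in the resolvent set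
  of \<open>T\<close> on the ambient space, and from the fact that \<open>T\<close> maps that space boundedly into \<open>V\<close>. The second
  (lemma \<open>discrete_stability\<close>) is a perturbation argument: if the graph of \<open>Th\<close> is close to the graph of \<open>T\<close>
  in the sense of the operator gap, then a lower bound for \<open>z - T\<close> carries over to \<open>z - Th\<close>. As \<open>S1\<close> is
  finite-dimensional, this lower bound also keeps the spectrum of \<open>Th\<close> off the circle.

  That \<open>T\<close> is defined everywhere, with values in \<open>V\<close>, is the Lax-Milgram lemma, developed for an inner product living on a subspace.\<close>

section \<open>Linear algebra in finite-dimensional subspaces\<close>

definition linear_on :: "'h::chilbert_space set \<Rightarrow> ('h \<Rightarrow> complex) \<Rightarrow> bool" where
  "linear_on S f \<longleftrightarrow> (\<forall>x\<in>S. \<forall>y\<in>S. f (x + y) = f x + f y) \<and> (\<forall>x\<in>S. \<forall>c. f (c *\<^sub>C x) = c * f x)"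

lemma linear_on_sum:
  assumes "linear_on S f" "complex_vector.subspace S" "\<And>i. i \<in> I \<Longrightarrow> g i \<in> S"
  shows "f (\<Sum>i\<in>I. c i *\<^sub>C g i) = (\<Sum>i\<in>I. c i * f (g i))"
proof -
  have f0: "f 0 = 0"
    using assms(1,2) complex_vector.subspace_0[OF assms(2)] unfolding linear_on_def
    by (metis add_cancel_right_right add.right_neutral)
  show ?thesis using assms(3)
  proof (induction I rule: infinite_finite_induct)
    case (insert i I)
    have "(\<Sum>i\<in>I. c i *\<^sub>C g i) \<in> S"
      using insert.prems by (intro complex_vector.subspace_sum complex_vector.subspace_scale assms(2)) auto
    moreover have "c i *\<^sub>C g i \<in> S"
      using insert.prems assms(2) by (simp add: complex_vector.subspace_scale)
    ultimately show ?case
      using insert assms(1) by (simp add: linear_on_def)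
  qed (simp_all add: f0)
qed

lemma linear_on_scale: "linear_on S f \<Longrightarrow> x \<in> S \<Longrightarrow> f (c *\<^sub>C x) = c * f x"
  unfolding linear_on_def by blast

lemma linear_on_diff:
  assumes "linear_on S f" "complex_vector.subspace S" "x \<in> S" "y \<in> S"
  shows "f (x - y) = f x - f y"
proof -
  have "f ((x - y) + y) = f (x - y) + f y"
    using assms complex_vector.subspace_diff unfolding linear_on_def by blast
  then show ?thesis by simp
qed

text \<open>Induction on the number of functionals. If dual vectors \<open>v\<close> for \<open>B\<close> are known and a further functional
  vanished on the common kernel of the old ones, it would be the combination of them with coefficients its values at
  the \<open>v b\<close>, because \<open>x - (\<Sum>b\<in>B. f b x *\<^sub>C v b)\<close> lies in that kernel. Hence some vector of the kernel
  is not annihilated by the new functional; normalized, it is the new dual vector and corrects the old ones.\<close>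

lemma dual_vectors_exist:
  fixes f :: "'b \<Rightarrow> 'h::chilbert_space \<Rightarrow> complex"
  assumes "finite B" and S: "complex_vector.subspace S"
    and lin: "\<And>b. b \<in> B \<Longrightarrow> linear_on S (f b)"
    and indep: "\<And>c. (\<And>x. x \<in> S \<Longrightarrow> (\<Sum>b\<in>B. c b * f b x) = 0) \<Longrightarrow> \<forall>b\<in>B. c b = 0"
  shows "\<exists>v. (\<forall>b\<in>B. v b \<in> S) \<and> (\<forall>b\<in>B. \<forall>b'\<in>B. f b (v b') = (if b = b' then 1 else 0))"
  using assms(1) lin indep
proof (induction B)
  case (insert b0 B)
  have "\<forall>b\<in>B. c b = 0" if c: "\<And>x. x \<in> S \<Longrightarrow> (\<Sum>b\<in>B. c b * f b x) = 0" for c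
  proof -
    let ?c = "\<lambda>b. if b = b0 then 0 else c b"
    have "(\<Sum>b\<in>insert b0 B. ?c b * f b x) = 0" if "x \<in> S" for x
    proof -
      have "(\<Sum>b\<in>insert b0 B. ?c b * f b x) = (\<Sum>b\<in>B. c b * f b x)"
        using insert.hyps by (auto intro!: sum.cong)
      with c[OF that] show ?thesis by simp
    qed
    from insert.prems(2)[OF this] have c0: "?c b = 0" if "b \<in> insert b0 B" for b using that by blast
    show ?thesis
    proof
      fix b assume "b \<in> B"
      then show "c b = 0" using c0[of b] insert.hyps by (cases "b = b0") auto
    qed
  qed
  then obtain v where v: "\<And>b. b \<in> B \<Longrightarrow> v b \<in> S"
      "\<And>b b'. b \<in> B \<Longrightarrow> b' \<in> B \<Longrightarrow> f b (v b') = (if b = b' then 1 else 0)"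
    using insert.IH insert.prems(1) by blast
  have "\<exists>x\<in>S. (\<forall>b\<in>B. f b x = 0) \<and> f b0 x \<noteq> 0"
  proof (rule ccontr)
    assume none: "\<not> ?thesis"
    let ?c = "\<lambda>b. if b = b0 then 1 else - f b0 (v b)"
    have "(\<Sum>b\<in>insert b0 B. ?c b * f b x) = 0" if x: "x \<in> S" for x
    proof -
      let ?p = "\<Sum>b\<in>B. f b x *\<^sub>C v b"
      have p: "?p \<in> S"
        using v S by (intro complex_vector.subspace_sum complex_vector.subspace_scale) auto
      have fp: "f b ?p = f b x" if "b \<in> B" for b
      proof -
        have "f b ?p = (\<Sum>b'\<in>B. f b' x * f b (v b'))"
          using that v(1) by (intro linear_on_sum[OF insert.prems(1) S]) auto
        also have "\<dots> = (\<Sum>b'\<in>B. if b' = b then f b x else 0)"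
          using that v by (intro sum.cong) auto
        finally show ?thesis using that insert.hyps by simp
      qed
      have "f b (x - ?p) = 0" if "b \<in> B" for b
        using linear_on_diff[OF insert.prems(1) S x p, of b] fp[OF that] that by auto
      then have "f b0 (x - ?p) = 0"
        using none complex_vector.subspace_diff[OF S x p] by blast
      then have "f b0 x = (\<Sum>b\<in>B. f b x * f b0 (v b))"
        using linear_on_diff[OF insert.prems(1) S x p, of b0]
          linear_on_sum[OF insert.prems(1) S, of b0 B v] v by auto
      moreover have "(\<Sum>b\<in>insert b0 B. ?c b * f b x) = f b0 x - (\<Sum>b\<in>B. f b x * f b0 (v b))"
      proof -
        have "(\<Sum>b\<in>B. ?c b * f b x) = (\<Sum>b\<in>B. - (f b x * f b0 (v b)))"
          using insert.hyps by (intro sum.cong) auto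
        then show ?thesis using insert.hyps by (simp add: sum_negf)
      qed
      ultimately show ?thesis by simp
    qed
    from insert.prems(2)[OF this] show False by auto
  qed
  then obtain x where x: "x \<in> S" "\<And>b. b \<in> B \<Longrightarrow> f b x = 0" "f b0 x \<noteq> 0" by auto
  define x0 where "x0 = (1 / f b0 x) *\<^sub>C x"
  have x0: "x0 \<in> S" "\<And>b. b \<in> B \<Longrightarrow> f b x0 = 0" "f b0 x0 = 1"
    unfolding x0_def
    using x linear_on_scale[OF insert.prems(1) x(1)] complex_vector.subspace_scale[OF S x(1)] by auto
  define w where "w = (\<lambda>b. if b = b0 then x0 else v b - f b0 (v b) *\<^sub>C x0)"
  have w_diff: "f b (v b' - f b0 (v b') *\<^sub>C x0) = f b (v b') - f b0 (v b') * f b x0"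
    if "b \<in> insert b0 B" "b' \<in> B" for b b'
    using linear_on_diff[OF insert.prems(1)[OF that(1)] S v(1)[OF that(2)]
        complex_vector.subspace_scale[OF S x0(1)]] linear_on_scale[OF insert.prems(1)[OF that(1)] x0(1)]
    by simp
  have "\<forall>b\<in>insert b0 B. w b \<in> S"
    unfolding w_def using x0(1) v(1) S
    by (auto intro: complex_vector.subspace_diff complex_vector.subspace_scale)
  moreover have "\<forall>b\<in>insert b0 B. \<forall>b'\<in>insert b0 B. f b (w b') = (if b = b' then 1 else 0)"
  proof (intro ballI)
    fix b b' assume b: "b \<in> insert b0 B" and b': "b' \<in> insert b0 B"
    show "f b (w b') = (if b = b' then 1 else 0)"
    proof (cases "b' = b0")
      case True
      then show ?thesis using b x0 insert.hyps unfolding w_def by auto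
    next
      case False
      with b' have b': "b' \<in> B" by blast
      have "f b (w b') = f b (v b') - f b0 (v b') * f b x0"
        using w_diff[OF b b'] False by (simp add: w_def)
      also have "\<dots> = (if b = b' then 1 else 0)"
        using b b' False x0(2)[of b] x0(3) v(2)[of b b'] by (cases "b = b0") auto
      finally show ?thesis .
    qed
  qed
  ultimately show ?case by blast
qed simp

lemma has_cdim_subspace: "has_cdim S n \<Longrightarrow> complex_vector.subspace S"
  unfolding has_cdim_def by auto

lemma independent_spans_has_cdim:
  assumes "has_cdim S n" "complex_vector.independent C" "C \<subseteq> S" "card C = n" "finite C"
  shows "complex_vector.span C = S"
proof -
  obtain B where B: "finite B" "card B = n" "complex_vector.span B = S"
    using assms(1) unfolding has_cdim_def by blast
  have "B \<subseteq> complex_vector.span C"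
  proof
    fix x assume x: "x \<in> B"
    show "x \<in> complex_vector.span C"
    proof (rule ccontr)
      assume nx: "x \<notin> complex_vector.span C"
      then have i: "complex_vector.independent (insert x C)"
        using assms(2) complex_vector.independent_insertI by blast
      have "insert x C \<subseteq> complex_vector.span B"
        using x assms(3) B complex_vector.span_base by auto
      from complex_vector.independent_span_bound[OF B(1) i this]
      have "card (insert x C) \<le> n" using B by simp
      moreover have "x \<notin> C" using nx complex_vector.span_base by auto
      ultimately show False using assms by simp
    qed
  qed
  then have "S \<subseteq> complex_vector.span C"
    using B(3) complex_vector.span_minimal complex_vector.subspace_span by blast
  moreover have "complex_vector.span C \<subseteq> S"
    using assms(1,3) has_cdim_subspace complex_vector.span_minimal by blast
  ultimately show ?thesis by blast
qed

lemma injective_linear_surjective_on: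
  assumes S: "has_cdim S n"
    and add: "\<And>x y. x \<in> S \<Longrightarrow> y \<in> S \<Longrightarrow> f (x + y) = f x + f y"
    and scale: "\<And>c x. x \<in> S \<Longrightarrow> f (c *\<^sub>C x) = c *\<^sub>C f x"
    and into: "\<And>x. x \<in> S \<Longrightarrow> f x \<in> S"
    and inj: "\<And>x. x \<in> S \<Longrightarrow> f x = 0 \<Longrightarrow> x = 0"
  shows "bij_betw f S S"
proof -
  note sub = has_cdim_subspace[OF S]
  obtain B where B: "finite B" "card B = n" "complex_vector.independent B" "complex_vector.span B = S"
    using S unfolding has_cdim_def by blast
  have BS: "B \<subseteq> S" using B(4) complex_vector.span_base by auto
  have diff: "f (x - y) = f x - f y" if "x \<in> S" "y \<in> S" for x y
    using add[of "x - y" y] complex_vector.subspace_diff[OF sub that] that by simp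
  have inj_on: "inj_on f S"
  proof (rule inj_onI)
    fix x y assume "x \<in> S" "y \<in> S" "f x = f y"
    then have "f (x - y) = 0" "x - y \<in> S"
      using diff[of x y] complex_vector.subspace_diff[OF sub, of x y] by simp_all
    then have "x - y = 0" by (rule inj[rotated])
    then show "x = y" by simp
  qed
  have f0: "f 0 = 0" using diff[of 0 0] complex_vector.subspace_0[OF sub] by simp
  have fsum: "f (\<Sum>b\<in>I. c b *\<^sub>C b) = (\<Sum>b\<in>I. c b *\<^sub>C f b)" if "finite I" "I \<subseteq> S" for c I
    using that
  proof (induction I)
    case (insert b I)
    have "(\<Sum>b\<in>I. c b *\<^sub>C b) \<in> S" "c b *\<^sub>C b \<in> S"
      using insert.prems sub by (auto intro!: complex_vector.subspace_sum complex_vector.subspace_scale)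
    then show ?case using insert add scale by simp
  qed (simp add: f0)
  have injB: "inj_on f B" using inj_on BS inj_on_subset by blast
  have "complex_vector.independent (f ` B)"
  proof (rule complex_vector.independent_if_scalars_zero)
    fix c x assume c: "(\<Sum>x\<in>f ` B. c x *\<^sub>C x) = 0" and x: "x \<in> f ` B"
    have "f (\<Sum>b\<in>B. c (f b) *\<^sub>C b) = 0"
      using c fsum[OF B(1) BS] by (simp add: sum.reindex[OF injB])
    moreover have "(\<Sum>b\<in>B. c (f b) *\<^sub>C b) \<in> S"
      using BS sub by (auto intro!: complex_vector.subspace_sum complex_vector.subspace_scale)
    ultimately have "(\<Sum>b\<in>B. c (f b) *\<^sub>C b) = 0" using inj by blast
    from complex_vector.independentD[OF B(3) B(1) subset_refl this] x show "c x = 0" by auto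
  qed (use B in auto)
  then have spanfB: "complex_vector.span (f ` B) = S"
    using independent_spans_has_cdim[OF S] B(1,2) BS into card_image[OF injB] by auto
  have "complex_vector.subspace (f ` S)"
  proof (rule complex_vector.subspaceI)
    show "0 \<in> f ` S" using f0 complex_vector.subspace_0[OF sub] by (intro image_eqI[of _ _ 0]) auto
    show "x + y \<in> f ` S" if xy: "x \<in> f ` S" "y \<in> f ` S" for x y
    proof -
      from xy obtain x' y' where "x' \<in> S" "y' \<in> S" "x = f x'" "y = f y'" by blast
      then show ?thesis
        using add[of x' y'] complex_vector.subspace_add[OF sub] by (intro image_eqI[of _ _ "x' + y'"]) auto
    qed
    show "c *\<^sub>C x \<in> f ` S" if x: "x \<in> f ` S" for c x
    proof -
      from x obtain x' where "x' \<in> S" "x = f x'" by blast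
      then show ?thesis
        using scale[of x' c] complex_vector.subspace_scale[OF sub] by (intro image_eqI[of _ _ "c *\<^sub>C x'"]) auto
    qed
  qed
  then have "S \<subseteq> f ` S"
    using spanfB complex_vector.span_minimal[of "f ` B" "f ` S"] BS by auto
  then show ?thesis using inj_on into unfolding bij_betw_def by auto
qed

section \<open>Sesquilinear forms and oblique projections\<close>

lemma sesquilinear_on_linear_on:
  assumes "sesquilinear_on V s" "S \<subseteq> V" "u \<in> V" shows "linear_on S (s u)"
  using assms unfolding sesquilinear_on_def linear_on_def by blast

lemma sesquilinear_on_simps:
  assumes "sesquilinear_on V s" "x \<in> V" "y \<in> V" 
  shows "z \<in> V \<Longrightarrow> s (x + y) z = s x z + s y z" "z \<in> V \<Longrightarrow> s x (y + z) = s x y + s x z"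
    "s (c *\<^sub>C x) y = cnj c * s x y" "s x (c *\<^sub>C y) = c * s x y"
  using assms unfolding sesquilinear_on_def by blast+

lemma sesquilinear_on_minus:
  assumes "sesquilinear_on V s" "complex_vector.subspace V" "x \<in> V" "y \<in> V" "z \<in> V"
  shows "s (x - y) z = s x z - s y z" "s x (y - z) = s x y - s x z"
  using sesquilinear_on_simps(1)[OF assms(1), of "x - y" y z]
    sesquilinear_on_simps(2)[OF assms(1), of x "y - z" z] assms(3-)
    complex_vector.subspace_diff[OF assms(2)] by auto

lemma sesquilinear_on_zero:
  assumes "sesquilinear_on V s" "complex_vector.subspace V" "x \<in> V"
  shows "s 0 x = 0" "s x 0 = 0"
  using sesquilinear_on_minus[OF assms(1,2) assms(3) assms(3) assms(3)] by auto

lemma sesquilinear_on_sum_left: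
  assumes "sesquilinear_on V s" "complex_vector.subspace V" "x \<in> V" "\<And>i. i \<in> I \<Longrightarrow> g i \<in> V"
  shows "s (\<Sum>i\<in>I. c i *\<^sub>C g i) x = (\<Sum>i\<in>I. cnj (c i) * s (g i) x)"
  using assms(4)
proof (induction I rule: infinite_finite_induct)
  case (insert i I)
  have "(\<Sum>i\<in>I. c i *\<^sub>C g i) \<in> V" "c i *\<^sub>C g i \<in> V"
    using insert.prems assms(2) by (auto intro!: complex_vector.subspace_sum complex_vector.subspace_scale)
  then show ?case
    using insert assms(3) sesquilinear_on_simps[OF assms(1)] by simp
qed (use sesquilinear_on_zero[OF assms(1-3)] in simp_all)

text \<open>Nondegeneracy on one side makes the functionals \<open>s b\<close>, for \<open>b\<close> in a basis of \<open>S2\<close>, independent on \<open>S1\<close>; a family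
  dual to them is independent, and because the two dimensions agree it is a basis of \<open>S1\<close>. Existence, uniqueness,
  linearity and continuity of the oblique projection can all be read off from the resulting formula.\<close>

lemma oblique_projection_expansion:
  assumes s: "sesquilinear_on V s" and V: "complex_vector.subspace V"
    and S: "S1 \<subseteq> V" "S2 \<subseteq> V" "has_cdim S1 n" "has_cdim S2 n"
    and nondeg: "\<forall>u\<in>S2. (\<forall>v\<in>S1. s u v = 0) \<longrightarrow> u = 0"
  shows "\<exists>B d. finite B \<and> B \<subseteq> S2 \<and> (\<forall>b\<in>B. d b \<in> S1) \<and>
    (\<forall>v\<in>V. \<forall>p. p \<in> S1 \<and> (\<forall>u\<in>S2. s u (v - p) = 0) \<longleftrightarrow> p = (\<Sum>b\<in>B. s b v *\<^sub>C d b))"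
proof -
  obtain B where B: "finite B" "card B = n" "complex_vector.independent B" "complex_vector.span B = S2"
    using S(4) unfolding has_cdim_def by blast
  have BS: "B \<subseteq> S2" using B(4) complex_vector.span_base by auto
  note sub1 = has_cdim_subspace[OF S(3)] and sub2 = has_cdim_subspace[OF S(4)]
  have lin: "linear_on S1 (s b)" if "b \<in> B" for b
    using that BS S s sesquilinear_on_linear_on by blast
  have "\<forall>b\<in>B. c b = 0" if c: "\<And>x. x \<in> S1 \<Longrightarrow> (\<Sum>b\<in>B. c b * s b x) = 0" for c
  proof -
    let ?u = "\<Sum>b\<in>B. cnj (c b) *\<^sub>C b"
    have "s ?u x = 0" if "x \<in> S1" for x
      using sesquilinear_on_sum_left[OF s V, of x B "\<lambda>b. b" "\<lambda>b. cnj (c b)"] BS S that c[OF that] by auto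
    moreover have "?u \<in> S2"
      using BS sub2 by (auto intro!: complex_vector.subspace_sum complex_vector.subspace_scale)
    ultimately have "?u = 0" using nondeg by blast
    from complex_vector.independentD[OF B(3) B(1) subset_refl this] show ?thesis by auto
  qed
  from dual_vectors_exist[OF B(1) sub1 lin this, of "\<lambda>b. b"] obtain d where
    d: "\<And>b. b \<in> B \<Longrightarrow> d b \<in> S1"
       "\<And>b b'. b \<in> B \<Longrightarrow> b' \<in> B \<Longrightarrow> s b (d b') = (if b = b' then 1 else 0)" by blast
  have sd: "s b (\<Sum>b'\<in>B. c b' *\<^sub>C d b') = c b" if "b \<in> B" for b c
  proof -
    have "s b (\<Sum>b'\<in>B. c b' *\<^sub>C d b') = (\<Sum>b'\<in>B. c b' * s b (d b'))"
      using linear_on_sum[OF lin[OF that] sub1] d by auto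
    also have "\<dots> = (\<Sum>b'\<in>B. if b' = b then c b else 0)"
      using that d by (intro sum.cong) auto
    finally show ?thesis using that B(1) by simp
  qed
  have sumd: "(\<Sum>b\<in>B. c b *\<^sub>C d b) \<in> S1" for c
    using d sub1 by (auto intro!: complex_vector.subspace_sum complex_vector.subspace_scale)
  have injd: "inj_on d B"
  proof (rule inj_onI)
    fix x y assume "x \<in> B" "y \<in> B" "d x = d y"
    with d(2)[of x x] d(2)[of x y] show "x = y" by (auto split: if_splits)
  qed
  have "complex_vector.independent (d ` B)"
  proof (rule complex_vector.independent_if_scalars_zero)
    fix c x assume c: "(\<Sum>x\<in>d ` B. c x *\<^sub>C x) = 0" and x: "x \<in> d ` B"
    then obtain b where b: "b \<in> B" "x = d b" by blast
    have "c (d b) = s b (\<Sum>b'\<in>B. c (d b') *\<^sub>C d b')" using sd[OF b(1), of "\<lambda>b. c (d b)"] by simp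
    also have "(\<Sum>b'\<in>B. c (d b') *\<^sub>C d b') = 0"
      using c by (simp add: sum.reindex[OF injd])
    also have "s b 0 = 0" using sesquilinear_on_zero[OF s V] b BS S by blast
    finally show "c x = 0" using b by simp
  qed (use B in auto)
  then have span: "complex_vector.span (d ` B) = S1"
    using independent_spans_has_cdim[OF S(3)] B(1,2) d(1) card_image[OF injd] by auto
  have expand: "p = (\<Sum>b\<in>B. s b p *\<^sub>C d b)" if p: "p \<in> S1" for p
  proof -
    obtain c where "p = (\<Sum>x\<in>d ` B. c x *\<^sub>C x)"
      using p B(1) span complex_vector.span_finite[of "d ` B"] by auto
    then have p': "p = (\<Sum>b\<in>B. c (d b) *\<^sub>C d b)" by (simp add: sum.reindex[OF injd])
    have "s b p = c (d b)" if "b \<in> B" for b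
      unfolding p' by (rule sd[OF that])
    then have "(\<Sum>b\<in>B. s b p *\<^sub>C d b) = (\<Sum>b\<in>B. c (d b) *\<^sub>C d b)"
      by (intro sum.cong) auto
    with p' show ?thesis by (rule trans[OF _ sym])
  qed
  show ?thesis
  proof (intro exI[of _ B] exI[of _ d] conjI ballI allI)
    fix v p assume v: "v \<in> V"
    have diff: "s b (v - q) = s b v - s b q" if "b \<in> S2" "q \<in> S1" for b q
      using sesquilinear_on_minus(2)[OF s V, of b v q] that v S by blast
    show "p \<in> S1 \<and> (\<forall>u\<in>S2. s u (v - p) = 0) \<longleftrightarrow> p = (\<Sum>b\<in>B. s b v *\<^sub>C d b)"
    proof
      assume p: "p \<in> S1 \<and> (\<forall>u\<in>S2. s u (v - p) = 0)"
      then have "s b v = s b p" if "b \<in> B" for b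
        using diff[of b p] that BS by auto
      then have "(\<Sum>b\<in>B. s b v *\<^sub>C d b) = (\<Sum>b\<in>B. s b p *\<^sub>C d b)"
        by (intro sum.cong) auto
      with expand[of p] p show "p = (\<Sum>b\<in>B. s b v *\<^sub>C d b)" by (blast intro: trans[OF _ sym])
    next
      assume p: "p = (\<Sum>b\<in>B. s b v *\<^sub>C d b)"
      have pS: "p \<in> S1" unfolding p by (rule sumd)
      have pV: "v - p \<in> V" using pS v S complex_vector.subspace_diff[OF V] by blast
      have b0: "s b (v - p) = 0" if "b \<in> B" for b
        using diff[of b p] pS that BS sd[OF that, of "\<lambda>b. s b v"] p by auto
      have "s u (v - p) = 0" if u: "u \<in> S2" for u
      proof -
        obtain c where "u = (\<Sum>x\<in>B. c x *\<^sub>C x)"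
          using u B(1,4) complex_vector.span_finite[of B] by auto
        then show ?thesis
          using sesquilinear_on_sum_left[OF s V pV, of B "\<lambda>b. b" c] BS S b0 by auto
      qed
      with pS show "p \<in> S1 \<and> (\<forall>u\<in>S2. s u (v - p) = 0)" by blast
    qed
  qed (use B BS d in auto)
qed

section \<open>Inner products on a subspace\<close>

text \<open>The left-hand side is the change of a quadratic functional under a shift by \<open>c\<close> times a vector of norm \<open>N\<close>;
  the optimal \<open>c\<close> is \<open>- g / N\<^sup>2\<close>. It serves both the Cauchy-Schwarz inequality and the Riesz representation.\<close>

lemma complex_completing_square:
  fixes g :: complex and N :: real
  assumes "N > 0"
  obtains c where "2 * Re (cnj c * g) + (cmod c)\<^sup>2 * N\<^sup>2 = - ((cmod g)\<^sup>2 / N\<^sup>2)"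
proof
  let ?c = "of_real (- 1 / N\<^sup>2) * g"
  have "cnj ?c * g = of_real (- 1 / N\<^sup>2) * (g * cnj g)" by simp
  also have "\<dots> = of_real (- 1 / N\<^sup>2 * (cmod g)\<^sup>2)"
    by (simp only: complex_norm_square[symmetric] of_real_mult)
  finally have "Re (cnj ?c * g) = - ((cmod g)\<^sup>2 / N\<^sup>2)" by (simp only: Re_complex_of_real) simp
  moreover have "(cmod ?c)\<^sup>2 * N\<^sup>2 = (cmod g)\<^sup>2 / N\<^sup>2"
    using assms by (simp add: norm_mult norm_divide norm_power power_mult_distrib power_divide power2_eq_square)
  ultimately show "2 * Re (cnj ?c * g) + (cmod ?c)\<^sup>2 * N\<^sup>2 = - ((cmod g)\<^sup>2 / N\<^sup>2)" by linarith
qed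

text \<open>The norm of \<open>V\<close> is not the norm of the type, so the elementary theory of inner products is redone for
  an inner product that is only meaningful on a subspace.\<close>

locale ip_space =
  fixes V :: "'h::chilbert_space set" and ip :: "'h \<Rightarrow> 'h \<Rightarrow> complex"
  assumes subspace_V: "complex_vector.subspace V" and ip: "inner_product_on V ip"
begin

abbreviation nrm :: "'h \<Rightarrow> real" where "nrm \<equiv> ipnorm ip"

lemma V_closed:
  "0 \<in> V" "x \<in> V \<Longrightarrow> y \<in> V \<Longrightarrow> x + y \<in> V" "x \<in> V \<Longrightarrow> y \<in> V \<Longrightarrow> x - y \<in> V" "x \<in> V \<Longrightarrow> c *\<^sub>C x \<in> V"
  using subspace_V complex_vector.subspace_0 complex_vector.subspace_add
    complex_vector.subspace_diff complex_vector.subspace_scale by blast+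

lemma sesquilinear: "sesquilinear_on V ip"
  using ip unfolding inner_product_on_def by blast

lemmas ip_simps = sesquilinear_on_simps[OF sesquilinear]
lemmas ip_minus = sesquilinear_on_minus[OF sesquilinear subspace_V]
lemmas ip_zero = sesquilinear_on_zero[OF sesquilinear subspace_V]

lemma ip_commute: "x \<in> V \<Longrightarrow> y \<in> V \<Longrightarrow> ip x y = cnj (ip y x)"
  using ip unfolding inner_product_on_def by blast

lemma ip_pos: "x \<in> V \<Longrightarrow> x \<noteq> 0 \<Longrightarrow> Re (ip x x) > 0"
  using ip unfolding inner_product_on_def by blast

lemma Re_ip_nonneg: "x \<in> V \<Longrightarrow> Re (ip x x) \<ge> 0"
  using ip_pos[of x] ip_zero[of x] by (cases "x = 0") auto

lemma nrm_nonneg: "x \<in> V \<Longrightarrow> nrm x \<ge> 0"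
  using Re_ip_nonneg by (simp add: ipnorm_def)

lemma nrm_square: "x \<in> V \<Longrightarrow> (nrm x)\<^sup>2 = Re (ip x x)"
  using Re_ip_nonneg by (simp add: ipnorm_def)

lemma ip_self: "x \<in> V \<Longrightarrow> ip x x = of_real ((nrm x)\<^sup>2)"
  using ip_commute[of x x] nrm_square by (simp add: complex_eq_iff)

lemma nrm_eq_0: "x \<in> V \<Longrightarrow> nrm x = 0 \<longleftrightarrow> x = 0"
  using ip_pos[of x] ip_zero[of 0] V_closed(1) by (cases "x = 0") (auto simp: ipnorm_def)

lemma nrm_0: "nrm 0 = 0"
  using nrm_eq_0 V_closed(1) by blast

lemma nrm_scale: "x \<in> V \<Longrightarrow> nrm (c *\<^sub>C x) = cmod c * nrm x"
proof -
  assume x: "x \<in> V"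
  have "ip (c *\<^sub>C x) (c *\<^sub>C x) = (c * cnj c) * ip x x"
    using x V_closed by (simp add: ip_simps)
  then have "Re (ip (c *\<^sub>C x) (c *\<^sub>C x)) = (cmod c)\<^sup>2 * Re (ip x x)"
    by (simp add: complex_norm_square[symmetric])
  then show ?thesis by (simp add: ipnorm_def real_sqrt_mult)
qed

lemma normalize:
  assumes "x \<in> V" "x \<noteq> 0"
  shows "nrm (of_real (1 / nrm x) *\<^sub>C x) = 1"
  using assms nrm_eq_0[of x] nrm_nonneg[of x] by (simp add: nrm_scale norm_divide)

lemma nrm_square_shift:
  assumes "x \<in> V" "w \<in> V"
  shows "(nrm (x + c *\<^sub>C w))\<^sup>2 = (nrm x)\<^sup>2 + 2 * Re (cnj c * ip w x) + (cmod c)\<^sup>2 * (nrm w)\<^sup>2"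
proof -
  have "ip (x + c *\<^sub>C w) (x + c *\<^sub>C w) = ip x x + c * ip x w + cnj c * ip w x + c * cnj c * ip w w"
    using assms V_closed by (simp add: ip_simps algebra_simps)
  moreover have "c * ip x w = cnj (cnj c * ip w x)"
    using ip_commute[OF assms] by simp
  moreover have "c * cnj c * ip w w = of_real ((cmod c)\<^sup>2 * (nrm w)\<^sup>2)"
    using ip_self[OF assms(2)] by (simp add: complex_norm_square[symmetric])
  ultimately have "Re (ip (x + c *\<^sub>C w) (x + c *\<^sub>C w))
      = Re (ip x x) + 2 * Re (cnj c * ip w x) + (cmod c)\<^sup>2 * (nrm w)\<^sup>2"
    by (simp del: of_real_mult of_real_power add: complex_eq_iff)
  then show ?thesis
    using nrm_square[OF assms(1)] nrm_square[of "x + c *\<^sub>C w"] assms V_closed by simp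
qed

lemma nrm_square_diff:
  assumes "x \<in> V" "y \<in> V"
  shows "(nrm (x - y))\<^sup>2 = (nrm x)\<^sup>2 - 2 * Re (ip y x) + (nrm y)\<^sup>2"
  using nrm_square_shift[OF assms, of "- 1"] by simp

lemma Cauchy_Schwarz:
  assumes "x \<in> V" "y \<in> V" shows "cmod (ip x y) \<le> nrm x * nrm y"
proof (cases "x = 0")
  case True then show ?thesis using ip_zero assms nrm_0 by simp
next
  case False
  then have pos: "nrm x > 0" using nrm_eq_0 nrm_nonneg assms by (simp add: less_le)
  obtain c where "2 * Re (cnj c * ip x y) + (cmod c)\<^sup>2 * (nrm x)\<^sup>2 = - ((cmod (ip x y))\<^sup>2 / (nrm x)\<^sup>2)"
    using complex_completing_square[OF pos] .
  then have "0 \<le> (nrm y)\<^sup>2 - (cmod (ip x y))\<^sup>2 / (nrm x)\<^sup>2"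
    using nrm_square_shift[OF assms(2,1), of c] zero_le_power2[of "nrm (y + c *\<^sub>C x)"] by linarith
  then have "(cmod (ip x y))\<^sup>2 \<le> (nrm x * nrm y)\<^sup>2"
    using pos by (simp add: field_simps power_mult_distrib)
  then show ?thesis
    using nrm_nonneg assms by (simp add: power2_le_iff_abs_le)
qed

lemma nrm_triangle:
  assumes "x \<in> V" "y \<in> V" shows "nrm (x + y) \<le> nrm x + nrm y"
proof -
  have "(nrm (x + y))\<^sup>2 = (nrm x)\<^sup>2 + 2 * Re (ip y x) + (nrm y)\<^sup>2"
    using nrm_square_shift[OF assms, of 1] by simp
  also have "\<dots> \<le> (nrm x)\<^sup>2 + 2 * (nrm y * nrm x) + (nrm y)\<^sup>2"
    using Cauchy_Schwarz[OF assms(2,1)] complex_Re_le_cmod[of "ip y x"] by simp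
  also have "\<dots> = (nrm x + nrm y)\<^sup>2" by (simp add: power2_sum)
  finally show ?thesis
    using nrm_nonneg assms by (simp add: power2_le_iff_abs_le)
qed

lemma nrm_minus_commute: "x \<in> V \<Longrightarrow> y \<in> V \<Longrightarrow> nrm (x - y) = nrm (y - x)"
  using nrm_scale[of "x - y" "-1"] V_closed by simp

lemma nrm_triangle_diff: "x \<in> V \<Longrightarrow> y \<in> V \<Longrightarrow> nrm (x - y) \<le> nrm x + nrm y"
  using nrm_triangle[of x "- y"] nrm_scale[of y "-1"] V_closed(4)[of y "-1"] by simp

lemma nrm_sum: "(\<And>i. i \<in> I \<Longrightarrow> f i \<in> V) \<Longrightarrow> nrm (sum f I) \<le> (\<Sum>i\<in>I. nrm (f i))"
proof (induction I rule: infinite_finite_induct)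
  case (insert i I)
  have "sum f I \<in> V"
    using insert.prems subspace_V by (intro complex_vector.subspace_sum) auto
  with insert show ?case using nrm_triangle[of "f i" "sum f I"] by fastforce
qed (simp_all add: nrm_0)

lemma nrm_sum_scale:
  assumes "\<And>i. i \<in> I \<Longrightarrow> f i \<in> V" "\<And>i. i \<in> I \<Longrightarrow> cmod (c i) \<le> k i"
  shows "nrm (\<Sum>i\<in>I. c i *\<^sub>C f i) \<le> (\<Sum>i\<in>I. k i * nrm (f i))"
proof -
  have "nrm (\<Sum>i\<in>I. c i *\<^sub>C f i) \<le> (\<Sum>i\<in>I. nrm (c i *\<^sub>C f i))"
    using assms(1) V_closed by (intro nrm_sum) auto
  also have "\<dots> \<le> (\<Sum>i\<in>I. k i * nrm (f i))"
    using assms nrm_nonneg by (intro sum_mono) (simp add: nrm_scale mult_right_mono)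
  finally show ?thesis .
qed

text \<open>Polarization; the sectoriality condition controls only the diagonal values of a form.\<close>

lemma bounded_form_of_bounded_diagonal:
  assumes s: "sesquilinear_on V s" and C: "\<And>v. v \<in> V \<Longrightarrow> cmod (s v v) \<le> C * (nrm v)\<^sup>2"
    and uv: "u \<in> V" "v \<in> V"
  shows "cmod (s u v) \<le> 4 * C * nrm u * nrm v"
proof -
  note sims = sesquilinear_on_simps[OF s]
  have unit: "cmod (s x y) \<le> 4 * C" if x: "x \<in> V" "nrm x = 1" and y: "y \<in> V" "nrm y = 1" for x y
  proof -
    have C0: "C \<ge> 0" using C[OF x(1)] x norm_ge_zero[of "s x x"] by (simp del: norm_ge_zero)
    have b: "cmod (s (x + c *\<^sub>C y) (x + c *\<^sub>C y)) \<le> 4 * C" if "cmod c = 1" for c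
    proof -
      have "nrm (x + c *\<^sub>C y) \<le> 2"
        using nrm_triangle[of x "c *\<^sub>C y"] x y V_closed that by (simp add: nrm_scale)
      then have "(nrm (x + c *\<^sub>C y))\<^sup>2 \<le> 2\<^sup>2"
        using nrm_nonneg x y V_closed by (intro power_mono) auto
      then have "C * (nrm (x + c *\<^sub>C y))\<^sup>2 \<le> C * 4"
        using C0 by (intro mult_left_mono) auto
      then show ?thesis
        using C[of "x + c *\<^sub>C y"] x y V_closed by (simp add: mult.commute)
    qed
    define q where "q c = s (x + c *\<^sub>C y) (x + c *\<^sub>C y)" for c
    have q: "q c = s x x + c * s x y + cnj c * s y x + c * cnj c * s y y" for c
      unfolding q_def using x y V_closed by (simp add: sims algebra_simps)
    \<comment> \<open>Polarization identity for a form that is conjugate linear in the first argument.\<close>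
    have "4 * s x y = q 1 - q (-1) - \<i> * q \<i> + \<i> * q (- \<i>)"
      unfolding q by (simp add: algebra_simps)
    then have "cmod (4 * s x y) \<le> cmod (q 1) + cmod (q (-1)) + cmod (q \<i>) + cmod (q (- \<i>))"
      using norm_triangle_ineq4[of "q 1" "q (-1)"] norm_triangle_ineq4[of "q 1 - q (-1)" "\<i> * q \<i>"]
        norm_triangle_ineq[of "q 1 - q (-1) - \<i> * q \<i>" "\<i> * q (- \<i>)"] by (simp add: norm_mult)
    also have "\<dots> \<le> 4 * (4 * C)"
      using b[of 1] b[of "-1"] b[of \<i>] b[of "-\<i>"] by (simp add: q_def)
    finally show ?thesis by (simp add: norm_mult)
  qed
  show ?thesis
  proof (cases "u = 0 \<or> v = 0")
    case True
    then show ?thesis using sesquilinear_on_zero[OF s subspace_V] uv nrm_0 by auto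
  next
    case False
    then have pos: "nrm u > 0" "nrm v > 0"
      using nrm_eq_0 nrm_nonneg uv by (auto simp: less_le)
    let ?x = "of_real (1 / nrm u) *\<^sub>C u" and ?y = "of_real (1 / nrm v) *\<^sub>C v"
    have "cmod (s ?x ?y) \<le> 4 * C"
      using pos uv V_closed by (intro unit) (simp_all add: nrm_scale norm_divide)
    moreover have "s ?x ?y = of_real (1 / (nrm u * nrm v)) * s u v"
      using uv V_closed by (simp add: sims)
    then have "cmod (s ?x ?y) = cmod (s u v) / (nrm u * nrm v)"
      using pos by (simp add: norm_mult norm_divide)
    ultimately have "cmod (s u v) / (nrm u * nrm v) \<le> 4 * C" by (simp only:)
    then have "cmod (s u v) \<le> 4 * C * (nrm u * nrm v)"
      using pos by (simp only: pos_divide_le_eq mult_pos_pos)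
    then show ?thesis by (simp only: mult.assoc)
  qed
qed

text \<open>The representing vector of \<open>f\<close> minimizes \<open>J x = (nrm x)\<^sup>2 - 2 * Re (f x)\<close>. If \<open>J x\<close> exceeds the infimum by
  \<open>t\<^sup>2\<close>, then moving \<open>x\<close> along \<open>w\<close> as far as is optimal shows \<open>cmod (ip w x - f w) \<le> nrm w * t\<close>; applied to
  \<open>w = x i - x j\<close>, the same inequality shows that minimizing sequences are Cauchy. The
  statement stops at the sequence because one application takes its limit in \<open>V\<close>, the other in the ambient space.\<close>

lemma Riesz_approximating_sequence:
  assumes add: "\<And>x y. x \<in> V \<Longrightarrow> y \<in> V \<Longrightarrow> f (x + y) = f x + f y"
    and scale: "\<And>c x. x \<in> V \<Longrightarrow> f (c *\<^sub>C x) = cnj c * f x"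
    and bound: "\<And>x. x \<in> V \<Longrightarrow> cmod (f x) \<le> C * nrm x"
  obtains x :: "nat \<Rightarrow> 'h" and e where "\<And>n. x n \<in> V" "e \<longlonglongrightarrow> 0"
    "\<And>i j. nrm (x i - x j) \<le> e i + e j"
    "\<And>n w. w \<in> V \<Longrightarrow> cmod (ip w (x n) - f w) \<le> nrm w * e n"
proof -
  define J where "J x = (nrm x)\<^sup>2 - 2 * Re (f x)" for x
  have J_lower: "- C\<^sup>2 \<le> J x" if x: "x \<in> V" for x
  proof -
    have "Re (f x) \<le> C * nrm x"
      using bound[OF x] complex_Re_le_cmod[of "f x"] by linarith
    moreover have "(nrm x)\<^sup>2 - 2 * (C * nrm x) + C\<^sup>2 = (nrm x - C)\<^sup>2"
      by (simp add: power2_diff)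
    ultimately show ?thesis
      unfolding J_def using zero_le_power2[of "nrm x - C"] by linarith
  qed
  define I where "I = (INF x\<in>V. J x)"
  have bdd: "bdd_below (J ` V)" using J_lower by (auto intro!: bdd_belowI2)
  have I: "I \<le> J x" if "x \<in> V" for x
    unfolding I_def using bdd that by (rule cINF_lower)
  have J_shift: "J (x + c *\<^sub>C w) = J x + 2 * Re (cnj c * (ip w x - f w)) + (cmod c)\<^sup>2 * (nrm w)\<^sup>2"
    if "x \<in> V" "w \<in> V" for x w c
    unfolding J_def using that V_closed
    by (simp add: nrm_square_shift add scale right_diff_distrib)
  have key: "cmod (ip w x - f w) \<le> nrm w * sqrt (J x - I)" if x: "x \<in> V" and w: "w \<in> V" for x w
  proof (cases "w = 0")
    case True
    have "f 0 = 0" using scale[of 0 0] V_closed(1) by simp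
    then show ?thesis using True ip_zero x by (simp add: nrm_0)
  next
    case False
    then have pos: "nrm w > 0" using nrm_eq_0 nrm_nonneg w by (simp add: less_le)
    define g where "g = ip w x - f w"
    obtain c where "2 * Re (cnj c * g) + (cmod c)\<^sup>2 * (nrm w)\<^sup>2 = - ((cmod g)\<^sup>2 / (nrm w)\<^sup>2)"
      using complex_completing_square[OF pos] .
    then have "I \<le> J x - (cmod g)\<^sup>2 / (nrm w)\<^sup>2"
      using J_shift[OF x w, of c] I[of "x + c *\<^sub>C w"] V_closed x w unfolding g_def by simp
    then have "(cmod g)\<^sup>2 \<le> (nrm w)\<^sup>2 * (J x - I)"
      using pos by (simp add: field_simps)
    then have "cmod g \<le> sqrt ((nrm w)\<^sup>2 * (J x - I))" by (rule real_le_rsqrt)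
    then show ?thesis using pos by (simp add: real_sqrt_mult g_def)
  qed
  have "\<exists>x\<in>V. J x < I + inverse (real (Suc n))" for n
    using cINF_less_iff[OF _ bdd, of "I + inverse (real (Suc n))"] V_closed(1) unfolding I_def by auto
  then obtain x where x: "\<And>n. x n \<in> V" "\<And>n. J (x n) < I + inverse (real (Suc n))" by metis
  define e where "e n = sqrt (J (x n) - I)" for n
  have fdiff: "f (y - z) = f y - f z" if "y \<in> V" "z \<in> V" for y z
    using add[of "y - z" z] that V_closed by simp
  show ?thesis
  proof
    show "x n \<in> V" for n by (rule x)
    show "cmod (ip w (x n) - f w) \<le> nrm w * e n" if "w \<in> V" for n w
      unfolding e_def using key x that by blast
    have "(\<lambda>n. J (x n) - I) \<longlonglongrightarrow> 0"
    proof (rule tendsto_sandwich[OF _ _ tendsto_const LIMSEQ_inverse_real_of_nat])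
      show "\<forall>\<^sub>F n in sequentially. 0 \<le> J (x n) - I" using I x(1) by auto
      show "\<forall>\<^sub>F n in sequentially. J (x n) - I \<le> inverse (real (Suc n))"
      proof (rule eventuallyI)
        show "J (x n) - I \<le> inverse (real (Suc n))" for n using x(2)[of n] by linarith
      qed
    qed
    from tendsto_real_sqrt[OF this] show "e \<longlonglongrightarrow> 0" unfolding e_def by simp
    show "nrm (x i - x j) \<le> e i + e j" for i j
    proof (cases "x i = x j")
      case True
      then show ?thesis using I[OF x(1)] nrm_0 unfolding e_def by simp
    next
      case False
      define d where "d = x i - x j"
      have d: "d \<in> V" "nrm d > 0"
        using False x V_closed nrm_eq_0[of d] nrm_nonneg[of d] unfolding d_def by (auto simp: less_le)
      have ipd: "ip d d = (ip d (x i) - f d) - (ip d (x j) - f d)"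
        using ip_minus(2)[of d "x i" "x j"] d x unfolding d_def by simp
      have "cmod (ip d d) \<le> nrm d * e i + nrm d * e j"
        unfolding ipd
        using norm_triangle_ineq4[of "ip d (x i) - f d" "ip d (x j) - f d"]
          key[OF x(1) d(1), of i] key[OF x(1) d(1), of j] unfolding e_def by linarith
      then have "nrm d * nrm d \<le> nrm d * (e i + e j)"
        using ip_self[OF d(1)] by (simp add: algebra_simps power2_eq_square norm_mult)
      then show ?thesis using d unfolding d_def by simp
    qed
  qed
qed

end

lemma tendsto_prod_sequentially_I:
  fixes g :: "nat \<Rightarrow> nat \<Rightarrow> real"
  assumes e: "e \<longlonglongrightarrow> 0" and g: "\<And>i j. 0 \<le> g i j" "\<And>i j. g i j \<le> e i + e j"
  shows "((\<lambda>(i, j). g i j) \<longlongrightarrow> 0) (sequentially \<times>\<^sub>F sequentially)"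
proof (rule tendsto_sandwich[OF _ _ tendsto_const])
  have "((\<lambda>p. e (fst p) + e (snd p)) \<longlongrightarrow> 0 + 0) (sequentially \<times>\<^sub>F sequentially)"
    by (intro tendsto_add filterlim_compose[OF e] filterlim_fst filterlim_snd)
  then show "((\<lambda>p. e (fst p) + e (snd p)) \<longlongrightarrow> 0) (sequentially \<times>\<^sub>F sequentially)" by simp
qed (use g in \<open>auto intro!: always_eventually\<close>)

section \<open>The ambient space, Riesz representation and the Lax-Milgram lemma\<close>

lemma ipnorm_cinner: "ipnorm cinner = norm"
  by (simp add: fun_eq_iff ipnorm_def norm_eq_sqrt_cinner)

lemma inner_product_on_cinner: "inner_product_on (V :: 'h::chilbert_space set) cinner"
  unfolding inner_product_on_def sesquilinear_on_def
proof (intro conjI ballI allI impI)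
  fix x y z :: 'h and c :: complex
  show "cinner x (y + z) = cinner x y + cinner x z" by (rule cinner_add_right)
  show "cinner (x + y) z = cinner x z + cinner y z"
    by (metis cinner_commute cinner_add_right complex_cnj_add)
  show "cinner x (c *\<^sub>C y) = c * cinner x y" by (rule cinner_scaleC_right)
  show "cinner (c *\<^sub>C x) y = cnj c * cinner x y"
    by (metis cinner_commute cinner_scaleC_right complex_cnj_mult)
  show "cinner x y = cnj (cinner y x)" by (rule cinner_commute)
  assume "x \<noteq> 0"
  then have "0 < sqrt (Re (cinner x x))" by (simp flip: norm_eq_sqrt_cinner)
  then show "Re (cinner x x) > 0" by simp
qed

lemma ip_space_cinner: "complex_vector.subspace V \<Longrightarrow> ip_space V cinner"
  using inner_product_on_cinner by unfold_locales

interpretation ambient: ip_space UNIV cinner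
  rewrites "ipnorm cinner = norm"
  by (simp_all add: ip_space_cinner complex_vector.subspace_UNIV ipnorm_cinner)

lemma bounded_linear_cinner_right: "bounded_linear (cinner x)"
proof (rule bounded_linear_intro[where K = "norm x"])
  fix y z and r :: real
  show "cinner x (y + z) = cinner x y + cinner x z" by (rule cinner_add_right)
  show "cinner x (r *\<^sub>R y) = r *\<^sub>R cinner x y"
    by (simp add: scaleR_scaleC cinner_scaleC_right scaleR_conv_of_real)
  show "norm (cinner x y) \<le> norm y * norm x"
    using ambient.Cauchy_Schwarz[of x y] by (simp add: mult.commute)
qed

text \<open>Needed for uniqueness of the vector that represents a functional on the dense form domain.\<close>

lemma dense_orthogonal_zero:
  assumes "closure V = UNIV" "\<And>w. w \<in> V \<Longrightarrow> cinner x w = 0"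
  shows "x = 0"
proof -
  have "x \<in> closure V" using assms by simp
  then obtain w where w: "\<And>n. w n \<in> V" "w \<longlonglongrightarrow> x" unfolding closure_sequential by blast
  from bounded_linear.tendsto[OF bounded_linear_cinner_right w(2), of x]
  have "(\<lambda>n. 0 :: complex) \<longlonglongrightarrow> cinner x x" using assms(2) w(1) by simp
  then have "cinner x x = 0" by (metis LIMSEQ_const_iff)
  then show ?thesis using ambient.ip_pos[of x] by force
qed

text \<open>This identifies the value of the operator associated with a form: a functional on the form domain that is bounded
  in the ambient norm is represented by a vector of the ambient space.\<close>

lemma Riesz_on_dense_subspace:
  fixes f :: "'h::chilbert_space \<Rightarrow> complex"
  assumes V: "complex_vector.subspace V"
    and add: "\<And>x y. x \<in> V \<Longrightarrow> y \<in> V \<Longrightarrow> f (x + y) = f x + f y"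
    and scale: "\<And>c x. x \<in> V \<Longrightarrow> f (c *\<^sub>C x) = cnj c * f x"
    and bound: "\<And>x. x \<in> V \<Longrightarrow> cmod (f x) \<le> C * norm x"
  obtains y where "\<And>w. w \<in> V \<Longrightarrow> cinner w y = f w"
proof -
  interpret ip_space V cinner
    rewrites "ipnorm cinner = norm"
    by (simp_all add: V ip_space_cinner ipnorm_cinner)
  from Riesz_approximating_sequence[OF add scale bound] obtain x e where
    x: "e \<longlonglongrightarrow> 0" "\<And>i j :: nat. norm (x i - x j) \<le> e i + e j"
    "\<And>n w. w \<in> V \<Longrightarrow> cmod (cinner w (x n) - f w) \<le> norm w * e n" by metis
  have "Cauchy x"
  proof (rule CauchyI)
    fix d :: real assume "0 < d"
    then have "\<forall>\<^sub>F n in sequentially. e n < d / 2"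
      using order_tendstoD(2)[OF x(1), of "d / 2"] by simp
    then obtain N where "\<And>n. n \<ge> N \<Longrightarrow> e n < d / 2" unfolding eventually_sequentially by blast
    then show "\<exists>M. \<forall>m\<ge>M. \<forall>n\<ge>M. norm (x m - x n) < d"
      using x(2) by (smt (verit) field_sum_of_halves)
  qed
  then obtain y where y: "x \<longlonglongrightarrow> y" using Cauchy_convergent convergent_def by blast
  show ?thesis
  proof
    fix w assume w: "w \<in> V"
    have "(\<lambda>n. cmod (cinner w (x n) - f w)) \<longlonglongrightarrow> cmod (cinner w y - f w)"
      by (intro tendsto_intros bounded_linear.tendsto[OF bounded_linear_cinner_right y])
    moreover have "(\<lambda>n. cmod (cinner w (x n) - f w)) \<longlonglongrightarrow> 0"
      by (rule tendsto_sandwich[OF _ _ tendsto_const tendsto_mult_right_zero[OF x(1)]])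
        (use x(3)[OF w] in \<open>auto intro!: always_eventually\<close>)
    ultimately show "cinner w y = f w" using LIMSEQ_unique by fastforce
  qed
qed

locale hilbert_subspace = ip_space +
  assumes hilbert: "hilbert_on V ip"
begin

lemma Cauchy_sequence_limit:
  assumes "\<And>n. x n \<in> V" "e \<longlonglongrightarrow> 0" "\<And>i j :: nat. nrm (x i - x j) \<le> e i + e j"
  obtains l where "l \<in> V" "(\<lambda>n. nrm (x n - l)) \<longlonglongrightarrow> 0"
proof -
  have "((\<lambda>(i, j). nrm (x i - x j)) \<longlongrightarrow> 0) (sequentially \<times>\<^sub>F sequentially)"
    using assms V_closed by (intro tendsto_prod_sequentially_I[of e] nrm_nonneg) auto
  then show ?thesis using that assms(1) hilbert unfolding hilbert_on_def by blast
qed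

lemma Riesz_representation:
  assumes add: "\<And>x y. x \<in> V \<Longrightarrow> y \<in> V \<Longrightarrow> f (x + y) = f x + f y"
    and scale: "\<And>c x. x \<in> V \<Longrightarrow> f (c *\<^sub>C x) = cnj c * f x"
    and bound: "\<And>x. x \<in> V \<Longrightarrow> cmod (f x) \<le> C * nrm x"
  obtains y where "y \<in> V" "\<And>w. w \<in> V \<Longrightarrow> ip w y = f w"
proof -
  from Riesz_approximating_sequence[OF add scale bound] obtain x e where
    x: "\<And>n. x n \<in> V" "e \<longlonglongrightarrow> 0" "\<And>i j :: nat. nrm (x i - x j) \<le> e i + e j"
    "\<And>n w. w \<in> V \<Longrightarrow> cmod (ip w (x n) - f w) \<le> nrm w * e n" by metis
  from Cauchy_sequence_limit[OF x(1-3)] obtain y where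
    y: "y \<in> V" "(\<lambda>n. nrm (x n - y)) \<longlonglongrightarrow> 0" .
  show ?thesis
  proof
    fix w assume w: "w \<in> V"
    have le: "cmod (ip w y - f w) \<le> nrm w * nrm (x n - y) + nrm w * e n" for n
    proof -
      have eq: "ip w y - f w = (ip w (x n) - f w) - ip w (x n - y)"
        using ip_minus(2)[OF w x(1) y(1)] by simp
      show ?thesis
        unfolding eq using norm_triangle_ineq4[of "ip w (x n) - f w" "ip w (x n - y)"] x(4)[OF w, of n]
          Cauchy_Schwarz[OF w V_closed(3)[OF x(1) y(1)], of n] by linarith
    qed
    have "(\<lambda>n. nrm w * nrm (x n - y) + nrm w * e n) \<longlonglongrightarrow> nrm w * 0 + nrm w * 0"
      by (intro tendsto_intros x y)
    then have "cmod (ip w y - f w) \<le> nrm w * 0 + nrm w * 0"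
      by (rule LIMSEQ_le_const) (use le in blast)
    then show "ip w y = f w" by simp
  qed (rule y)
qed

text \<open>Picard iteration from \<open>0\<close>. A bound \<open>R\<close> on \<open>nrm (x 0 - x m)\<close> that is uniform in \<open>m\<close> gives
  \<open>nrm (x n - x (n + m)) \<le> R * q ^ n\<close>.\<close>

lemma contraction_fixed_point:
  assumes F: "\<And>x. x \<in> V \<Longrightarrow> F x \<in> V" and q: "0 \<le> q" "q < 1"
    and contr: "\<And>x y. x \<in> V \<Longrightarrow> y \<in> V \<Longrightarrow> nrm (F x - F y) \<le> q * nrm (x - y)"
  obtains l where "l \<in> V" "F l = l"
proof -
  define x where "x n = (F ^^ n) 0" for n
  have x: "x n \<in> V" for n
    unfolding x_def by (induction n) (auto simp: V_closed F)
  define R where "R = nrm (x 0 - x 1) / (1 - q)"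
  have R: "nrm (x 0 - x 1) + q * R = R"
    unfolding R_def using q by (simp add: field_simps)
  have R0: "0 \<le> R" unfolding R_def using q nrm_nonneg V_closed(3)[OF x x] by simp
  have first: "nrm (x 0 - x m) \<le> R" for m
  proof (induction m)
    case 0 then show ?case using R0 nrm_0 by simp
  next
    case (Suc m)
    have "nrm (x 0 - x (Suc m)) \<le> nrm (x 0 - x 1) + nrm (x 1 - x (Suc m))"
      using nrm_triangle[of "x 0 - x 1" "x 1 - x (Suc m)"] V_closed(3)[OF x x] by simp
    also have "nrm (x 1 - x (Suc m)) \<le> q * nrm (x 0 - x m)"
      using contr[OF x x, of 0 m] unfolding x_def by simp
    also have "q * nrm (x 0 - x m) \<le> q * R" using Suc q by (intro mult_left_mono) auto
    finally show ?case using R by simp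
  qed
  have later: "nrm (x n - x (n + m)) \<le> R * q ^ n" for n m
  proof (induction n)
    case 0 then show ?case using first by simp
  next
    case (Suc n)
    have "nrm (x (Suc n) - x (Suc n + m)) \<le> q * nrm (x n - x (n + m))"
      using contr[OF x x, of n "n + m"] unfolding x_def by simp
    also have "\<dots> \<le> q * (R * q ^ n)" using Suc q by (intro mult_left_mono) auto
    finally show ?case by (simp add: mult_ac)
  qed
  have "nrm (x i - x j) \<le> R * q ^ i + R * q ^ j" for i j
  proof (cases "i \<le> j")
    case True
    then show ?thesis using later[of i "j - i"] R0 q by (simp add: add_increasing2)
  next
    case False
    then show ?thesis using later[of j "i - j"] nrm_minus_commute[OF x x, of i j] R0 q
      by (simp add: add_increasing)
  qed
  moreover have "(\<lambda>n. R * q ^ n) \<longlonglongrightarrow> 0"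
    using q by (intro tendsto_mult_right_zero LIMSEQ_power_zero) simp
  ultimately obtain l where l: "l \<in> V" "(\<lambda>n. nrm (x n - l)) \<longlonglongrightarrow> 0"
    using Cauchy_sequence_limit[of x "\<lambda>n. R * q ^ n"] x by metis
  have "nrm (F l - l) \<le> q * nrm (x n - l) + nrm (x (Suc n) - l)" for n
  proof -
    have "nrm (F l - l) \<le> nrm (F l - x (Suc n)) + nrm (x (Suc n) - l)"
      using nrm_triangle[of "F l - x (Suc n)" "x (Suc n) - l"] V_closed(3) x l F by simp
    also have "nrm (F l - x (Suc n)) \<le> q * nrm (l - x n)"
      using contr[OF l(1) x, of n] unfolding x_def by simp
    finally show ?thesis using nrm_minus_commute[OF l(1) x] by simp
  qed
  moreover have "(\<lambda>n. q * nrm (x n - l) + nrm (x (Suc n) - l)) \<longlonglongrightarrow> q * 0 + 0"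
    by (intro tendsto_intros l(2) LIMSEQ_Suc[OF l(2)])
  ultimately have "nrm (F l - l) \<le> q * 0 + 0"
    by (intro LIMSEQ_le_const) auto
  then have "F l - l = 0"
    using nrm_eq_0[of "F l - l"] nrm_nonneg[of "F l - l"] V_closed(3) F l by auto
  then show ?thesis using that l by simp
qed

text \<open>With \<open>B\<close> and \<open>g\<close> representing the form and the functional, \<open>x - \<rho> (B x - g)\<close> is a contraction for small
  positive \<open>\<rho>\<close>: the square of its Lipschitz constant is at most \<open>1 - 2 \<rho> k + \<rho>\<^sup>2 C\<^sup>2\<close>.\<close>

lemma Lax_Milgram:
  assumes s: "sesquilinear_on V s"
    and bounded: "\<And>u v. u \<in> V \<Longrightarrow> v \<in> V \<Longrightarrow> cmod (s u v) \<le> C * nrm u * nrm v"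
    and coercive: "k > 0" "\<And>v. v \<in> V \<Longrightarrow> k * (nrm v)\<^sup>2 \<le> Re (s v v)"
    and add: "\<And>x y. x \<in> V \<Longrightarrow> y \<in> V \<Longrightarrow> f (x + y) = f x + f y"
    and scale: "\<And>c x. x \<in> V \<Longrightarrow> f (c *\<^sub>C x) = cnj c * f x"
    and bound: "\<And>x. x \<in> V \<Longrightarrow> cmod (f x) \<le> K * nrm x"
  obtains y where "y \<in> V" "\<And>w. w \<in> V \<Longrightarrow> s w y = f w"
proof -
  note sims = sesquilinear_on_simps[OF s]
  \<comment> \<open>If \<open>V\<close> is the zero space, \<open>C\<close> may be smaller than \<open>k\<close>, and \<open>1 - k\<^sup>2 / C\<^sup>2\<close> negative.\<close>
  define C' where "C' = max C k"
  have C': "C' > 0" "k \<le> C'" using coercive(1) by (auto simp: C'_def)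
  have bounded': "cmod (s u v) \<le> C' * nrm u * nrm v" if "u \<in> V" "v \<in> V" for u v
  proof -
    have "C * (nrm u * nrm v) \<le> C' * (nrm u * nrm v)"
      using that nrm_nonneg by (intro mult_right_mono) (auto simp: C'_def)
    then show ?thesis using bounded[OF that] by (simp add: mult.assoc)
  qed
  obtain g where g: "g \<in> V" "\<And>w. w \<in> V \<Longrightarrow> ip w g = f w"
    using Riesz_representation[OF add scale bound] by metis
  have "\<exists>y\<in>V. \<forall>w\<in>V. ip w y = s w v" if v: "v \<in> V" for v
  proof -
    have "cmod (s x v) \<le> (C' * nrm v) * nrm x" if "x \<in> V" for x
      using bounded'[OF that v] by (simp add: mult_ac)
    then obtain y where "y \<in> V" "\<And>w. w \<in> V \<Longrightarrow> ip w y = s w v"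
      using Riesz_representation[of "\<lambda>w. s w v" "C' * nrm v"] sims v by metis
    then show ?thesis by blast
  qed
  then obtain B where B: "\<And>v. v \<in> V \<Longrightarrow> B v \<in> V" "\<And>v w. v \<in> V \<Longrightarrow> w \<in> V \<Longrightarrow> ip w (B v) = s w v"
    by metis
  \<comment> \<open>The minimizer of the quadratic \<open>1 - 2 \<rho> k + \<rho>\<^sup>2 C'\<^sup>2\<close>, with minimal value \<open>1 - k\<^sup>2 / C'\<^sup>2\<close>.\<close>
  define \<rho> where "\<rho> = k / C'\<^sup>2"
  have \<rho>: "\<rho> > 0" using C' coercive(1) by (simp add: \<rho>_def)
  define F where "F x = x - of_real \<rho> *\<^sub>C (B x - g)" for x
  define q where "q = sqrt (1 - k\<^sup>2 / C'\<^sup>2)"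
  have q: "0 \<le> q" "q < 1" "q\<^sup>2 = 1 - k\<^sup>2 / C'\<^sup>2"
    using C' coercive(1) power_mono[OF C'(2), of 2] by (auto simp: q_def field_simps)
  have FV: "F x \<in> V" if "x \<in> V" for x
    unfolding F_def using that V_closed B g by auto
  have "nrm (F x - F y) \<le> q * nrm (x - y)" if x: "x \<in> V" and y: "y \<in> V" for x y
  proof -
    define d where "d = x - y"
    define b where "b = of_real \<rho> *\<^sub>C (B x - B y)"
    have d: "d \<in> V" and b: "b \<in> V"
      unfolding d_def b_def using x y B V_closed by auto
    have e: "F x - F y = d - b"
      unfolding F_def d_def b_def
      by (simp add: complex_vector.scale_right_diff_distrib)
    have ipb: "ip w b = of_real \<rho> * s w d" if w: "w \<in> V" for w
      unfolding b_def d_def using w x y B V_closed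
      by (simp add: ip_simps ip_minus sesquilinear_on_minus[OF s subspace_V])
    have nb: "nrm b \<le> \<rho> * C' * nrm d"
    proof (cases "nrm b = 0")
      case False
      then have pos: "nrm b > 0" using nrm_nonneg[OF b] by linarith
      have "nrm b * nrm b = cmod (of_real \<rho> * s b d)"
        using ipb[OF b] ip_self[OF b] by (metis norm_of_real abs_of_nonneg zero_le_power2 power2_eq_square)
      also have "\<dots> \<le> \<rho> * (C' * nrm b * nrm d)"
        using bounded'[OF b d] \<rho> by (simp add: norm_mult)
      also have "\<dots> = nrm b * (\<rho> * C' * nrm d)" by simp
      finally show ?thesis using pos by simp
    qed (use \<rho> C' nrm_nonneg[OF d] in simp)
    have "Re (ip b d) = \<rho> * Re (s d d)"
      using ip_commute[OF b d] ipb[OF d] by simp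
    moreover have "\<rho> * (k * (nrm d)\<^sup>2) \<le> \<rho> * Re (s d d)"
      using coercive(2)[OF d] \<rho> by simp
    moreover have "(nrm b)\<^sup>2 \<le> (\<rho> * C' * nrm d)\<^sup>2"
      using nb nrm_nonneg[OF b] by (intro power_mono) auto
    ultimately have "(nrm (d - b))\<^sup>2 \<le> (nrm d)\<^sup>2 - 2 * (\<rho> * (k * (nrm d)\<^sup>2)) + (\<rho> * C' * nrm d)\<^sup>2"
      using nrm_square_diff[OF d b] by linarith
    also have "\<dots> = (q * nrm d)\<^sup>2"
      unfolding power_mult_distrib q(3) \<rho>_def using C'
      by (simp add: field_simps power2_eq_square)
    finally show ?thesis
      unfolding e d_def[symmetric] using q nrm_nonneg[OF d] by (simp add: power2_le_iff_abs_le)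
  qed
  from contraction_fixed_point[OF FV q(1,2) this] obtain y where y: "y \<in> V" "F y = y" by blast
  have By: "B y = g" using y(2) \<rho> unfolding F_def by simp
  show ?thesis
  proof
    show "s w y = f w" if "w \<in> V" for w using B(2)[OF y(1) that] g(2)[OF that] By by simp
  qed (rule y)
qed

end

section \<open>The operator of a coercive form and its inverse\<close>

locale sectorial_form = hilbert_subspace +
  fixes a :: "'a \<Rightarrow> 'a \<Rightarrow> complex" and \<alpha> M :: real
  assumes \<alpha>: "\<alpha> > 0" and M: "M > 0"
    and form: "closed_sectorial_form V a \<alpha> M"
    and equivalent: "equivalent_ip_on V ip (form_real_part a)"
begin

lemma dense: "closure V = UNIV" and a: "sesquilinear_on V a"
  using form unfolding closed_sectorial_form_def by blast+

lemmas a_simps = sesquilinear_on_simps[OF a]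
lemmas a_minus = sesquilinear_on_minus[OF a subspace_V]
lemmas a_zero = sesquilinear_on_zero[OF a subspace_V]

lemma Re_a_lower: "v \<in> V \<Longrightarrow> \<alpha> * (norm v)\<^sup>2 \<le> Re (a v v)"
  and Im_a_upper: "v \<in> V \<Longrightarrow> \<bar>Im (a v v)\<bar> \<le> M * (Re (a v v) - \<alpha> * (norm v)\<^sup>2)"
  using form unfolding closed_sectorial_form_def by blast+

lemma nrm_equivalent_Re_a:
  obtains k K where "k > 0" "K > 0" "\<And>v. v \<in> V \<Longrightarrow> k * (nrm v)\<^sup>2 \<le> Re (a v v)"
    "\<And>v. v \<in> V \<Longrightarrow> Re (a v v) \<le> K * (nrm v)\<^sup>2"
proof -
  obtain k K where kK: "k > 0" "K > 0"
    "\<And>v. v \<in> V \<Longrightarrow> k * ipnorm (form_real_part a) v \<le> nrm v \<and> nrm v \<le> K * ipnorm (form_real_part a) v"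
    using equivalent unfolding equivalent_ip_on_def by blast
  have "Re (a v v) \<ge> 0" if "v \<in> V" for v
    using Re_a_lower[OF that] \<alpha> by (meson less_imp_le mult_nonneg_nonneg order_trans zero_le_power2)
  then have sq: "(ipnorm (form_real_part a) v)\<^sup>2 = Re (a v v)" if "v \<in> V" for v
    using that by (simp add: ipnorm_def form_real_part_def)
  have nn: "0 \<le> ipnorm (form_real_part a) v" if "v \<in> V" for v
    using \<open>v \<in> V \<Longrightarrow> 0 \<le> Re (a v v)\<close> that by (simp add: ipnorm_def form_real_part_def)
  show ?thesis
  proof
    fix v assume v: "v \<in> V"
    have "(k * ipnorm (form_real_part a) v)\<^sup>2 \<le> (nrm v)\<^sup>2"
      using kK v nn by (intro power_mono) auto
    then show "Re (a v v) \<le> (1 / k\<^sup>2) * (nrm v)\<^sup>2"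
      using kK(1) v by (simp add: power_mult_distrib sq field_simps)
    have "(nrm v)\<^sup>2 \<le> (K * ipnorm (form_real_part a) v)\<^sup>2"
      using kK v nrm_nonneg by (intro power_mono) auto
    then show "(1 / K\<^sup>2) * (nrm v)\<^sup>2 \<le> Re (a v v)"
      using kK(2) v by (simp add: power_mult_distrib sq field_simps)
  qed (use kK in auto)
qed

lemma a_coercive: obtains k where "k > 0" "\<And>v. v \<in> V \<Longrightarrow> k * (nrm v)\<^sup>2 \<le> Re (a v v)"
  using nrm_equivalent_Re_a by metis

lemma a_bounded:
  obtains C where "C > 0" "\<And>u v. u \<in> V \<Longrightarrow> v \<in> V \<Longrightarrow> cmod (a u v) \<le> C * nrm u * nrm v"
proof -
  obtain k K where K: "K > 0" "\<And>v. v \<in> V \<Longrightarrow> Re (a v v) \<le> K * (nrm v)\<^sup>2"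
    using nrm_equivalent_Re_a by metis
  have "cmod (a v v) \<le> ((1 + M) * K) * (nrm v)\<^sup>2" if v: "v \<in> V" for v
  proof -
    have nn: "0 \<le> \<alpha> * (norm v)\<^sup>2" using \<alpha> by simp
    then have "M * (Re (a v v) - \<alpha> * (norm v)\<^sup>2) \<le> M * Re (a v v)" using M by simp
    then have "cmod (a v v) \<le> (1 + M) * Re (a v v)"
      using cmod_le[of "a v v"] Im_a_upper[OF v] Re_a_lower[OF v] nn by (simp add: algebra_simps)
    also have "\<dots> \<le> (1 + M) * (K * (nrm v)\<^sup>2)"
      using K(2)[OF v] M by (intro mult_left_mono) auto
    finally show ?thesis by (simp add: mult.assoc)
  qed
  from bounded_form_of_bounded_diagonal[OF a this] show ?thesis
    using K M by (intro that[of "4 * ((1 + M) * K)"]) auto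
qed

lemma norm_le_nrm: obtains c where "c > 0" "\<And>v. v \<in> V \<Longrightarrow> norm v \<le> c * nrm v"
proof -
  obtain k K where K: "K > 0" "\<And>v. v \<in> V \<Longrightarrow> Re (a v v) \<le> K * (nrm v)\<^sup>2"
    using nrm_equivalent_Re_a by metis
  show ?thesis
  proof
    show "sqrt (K / \<alpha>) > 0" using K \<alpha> by simp
    fix v assume v: "v \<in> V"
    have "(norm v)\<^sup>2 \<le> (K / \<alpha>) * (nrm v)\<^sup>2"
      using Re_a_lower[OF v] K(2)[OF v] \<alpha> by (simp add: field_simps)
    then have "sqrt ((norm v)\<^sup>2) \<le> sqrt ((K / \<alpha>) * (nrm v)\<^sup>2)" by (rule real_sqrt_le_mono)
    then show "norm v \<le> sqrt (K / \<alpha>) * nrm v"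
      using nrm_nonneg[OF v] by (simp only: real_sqrt_mult real_sqrt_abs abs_of_nonneg abs_norm_cancel)
  qed
qed

lemma a_right_zero:
  assumes "v \<in> V" "\<And>u. u \<in> V \<Longrightarrow> a u v = 0" shows "v = 0"
proof -
  obtain k where k: "k > 0" "k * (nrm v)\<^sup>2 \<le> Re (a v v)" using a_coercive assms by metis
  then have "(nrm v)\<^sup>2 \<le> 0" using assms by (simp add: mult_le_0_iff)
  then show ?thesis using nrm_eq_0 assms by simp
qed

lemma weak_solution_exists:
  obtains t where "t \<in> V" "\<And>u. u \<in> V \<Longrightarrow> a u t = cinner u v"
proof -
  obtain k where k: "k > 0" "\<And>v. v \<in> V \<Longrightarrow> k * (nrm v)\<^sup>2 \<le> Re (a v v)" using a_coercive by blast
  obtain C where C: "\<And>u v. u \<in> V \<Longrightarrow> v \<in> V \<Longrightarrow> cmod (a u v) \<le> C * nrm u * nrm v"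
    using a_bounded by metis
  obtain c where c: "c > 0" "\<And>v. v \<in> V \<Longrightarrow> norm v \<le> c * nrm v" using norm_le_nrm by blast
  have bd: "cmod (cinner x v) \<le> (c * norm v) * nrm x" if "x \<in> V" for x
  proof -
    have "cmod (cinner x v) \<le> norm x * norm v" using ambient.Cauchy_Schwarz by simp
    also have "\<dots> \<le> (c * nrm x) * norm v" using c that by (intro mult_right_mono) auto
    finally show ?thesis by (simp add: mult_ac)
  qed
  show ?thesis
  proof (rule Lax_Milgram[OF a C k, where f = "\<lambda>w. cinner w v"])
    show "cinner (x + y) v = cinner x v + cinner y v" for x y
      using ambient.ip_simps(1) by simp
    show "cinner (c *\<^sub>C x) v = cnj c * cinner x v" for c x
      using ambient.ip_simps(3) by simp
    show "cmod (cinner x v) \<le> (c * norm v) * nrm x" if "x \<in> V" for x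
      by (rule bd[OF that])
  qed (use that in auto)
qed

lemma form_op_represents:
  assumes v: "v \<in> form_dom V a" and w: "w \<in> V"
  shows "a w v = cinner w (form_op V a v)"
proof -
  obtain m where vV: "v \<in> V" and m: "\<And>w. w \<in> V \<Longrightarrow> cmod (a w v) \<le> m * norm w"
    using v unfolding form_dom_def by blast
  obtain f where f: "\<And>w. w \<in> V \<Longrightarrow> cinner w f = a w v"
    using Riesz_on_dense_subspace[OF subspace_V, of "\<lambda>w. a w v" m] a_simps vV m by metis
  have "\<forall>w\<in>V. a w v = cinner w (form_op V a v)"
    unfolding form_op_def
  proof (rule theI[of _ f])
    show "\<forall>w\<in>V. a w v = cinner w f" using f by simp
    fix g assume "\<forall>w\<in>V. a w v = cinner w g"
    then have "cinner w (g - f) = 0" if "w \<in> V" for w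
      using f[OF that] that ambient.ip_minus(2)[of w g f] by simp
    then have "cinner (g - f) w = 0" if "w \<in> V" for w
      using that by (metis cinner_commute complex_cnj_zero)
    from dense_orthogonal_zero[OF dense this] show "g = f" by simp
  qed
  with w show ?thesis by blast
qed

lemma form_op_eqI:
  assumes "v \<in> V" "\<And>w. w \<in> V \<Longrightarrow> a w v = cinner w f"
  shows "v \<in> form_dom V a" "form_op V a v = f"
proof -
  have "cmod (a w v) \<le> norm f * norm w" if "w \<in> V" for w
    using assms(2)[OF that] ambient.Cauchy_Schwarz[of w f] by (simp add: mult.commute)
  then show dom: "v \<in> form_dom V a" unfolding form_dom_def using assms by blast
  have "cinner w (form_op V a v - f) = 0" if "w \<in> V" for w
    using assms(2)[OF that] form_op_represents[OF dom that] ambient.ip_minus(2)[of w "form_op V a v" f] by simp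
  then have "cinner (form_op V a v - f) w = 0" if "w \<in> V" for w
    using that by (metis cinner_commute complex_cnj_zero)
  from dense_orthogonal_zero[OF dense this] show "form_op V a v = f" by simp
qed

abbreviation D :: "'a set" where "D \<equiv> form_dom V a"
abbreviation A :: "'a \<Rightarrow> 'a" where "A \<equiv> form_op V a"
abbreviation T :: "'a \<Rightarrow> 'a" where "T \<equiv> form_inv V a"

lemma D_subset_V: "D \<subseteq> V" unfolding form_dom_def by blast

lemma A_inj: "inj_on A D"
proof (rule inj_onI)
  fix x y assume xy: "x \<in> D" "y \<in> D" "A x = A y"
  then have V: "x \<in> V" "y \<in> V" using D_subset_V by auto
  have "a u (x - y) = 0" if "u \<in> V" for u
    using form_op_represents[OF xy(1) that] form_op_represents[OF xy(2) that] xy(3) a_minus(2)[OF that V] by simp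
  from a_right_zero[OF V_closed(3)[OF V] this] show "x = y" by simp
qed

lemma T_solves: "T v \<in> D" "A (T v) = v" "u \<in> V \<Longrightarrow> a u (T v) = cinner u v"
proof -
  obtain t where t: "t \<in> V" "\<And>u. u \<in> V \<Longrightarrow> a u t = cinner u v" using weak_solution_exists[of v] by blast
  have v: "v \<in> A ` D" using form_op_eqI[OF t] by blast
  show "T v \<in> D" unfolding form_inv_def using the_inv_into_into[OF A_inj v] by blast
  show "A (T v) = v" unfolding form_inv_def by (rule f_the_inv_into_f[OF A_inj v])
  then show "u \<in> V \<Longrightarrow> a u (T v) = cinner u v"
    using form_op_represents[OF \<open>T v \<in> D\<close>] by simp
qed

lemma T_in_V: "T v \<in> V" using T_solves(1) D_subset_V by blast

lemma T_A: "v \<in> D \<Longrightarrow> T (A v) = v"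
  unfolding form_inv_def by (rule the_inv_into_f_f[OF A_inj])

lemma T_eqI: "t \<in> V \<Longrightarrow> (\<And>u. u \<in> V \<Longrightarrow> a u t = cinner u v) \<Longrightarrow> T v = t"
  using form_op_eqI[of t v] T_A by metis

lemma T_add: "T (x + y) = T x + T y"
  using T_in_V V_closed(2) by (intro T_eqI) (auto simp: a_simps T_solves cinner_add_right)

lemma T_scale: "T (c *\<^sub>C x) = c *\<^sub>C T x"
  using T_in_V V_closed(4) by (intro T_eqI) (auto simp: a_simps T_solves cinner_scaleC_right)

lemma T_0: "T 0 = 0" using T_scale[of 0 0] by simp

lemma T_diff: "T (x - y) = T x - T y"
  using T_add[of "x - y" y] by simp

lemma T_inj: "T x = 0 \<Longrightarrow> x = 0"
  using T_solves(2)[of x] T_solves(2)[of 0] T_0 by metis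

text \<open>Coercivity, tested with \<open>T v\<close>. It gains from the ambient norm of \<open>v\<close> to the stronger norm of \<open>V\<close>.\<close>

lemma T_bounded: obtains c where "c > 0" "\<And>v. nrm (T v) \<le> c * norm v"
proof -
  obtain k where k: "k > 0" "\<And>v. v \<in> V \<Longrightarrow> k * (nrm v)\<^sup>2 \<le> Re (a v v)" using a_coercive by blast
  obtain c where c: "c > 0" "\<And>v. v \<in> V \<Longrightarrow> norm v \<le> c * nrm v" using norm_le_nrm by blast
  show ?thesis
  proof
    show "c / k > 0" using k c by simp
    fix v
    have "k * (nrm (T v))\<^sup>2 \<le> Re (cinner (T v) v)"
      using k(2)[OF T_in_V] T_solves(3)[OF T_in_V] by metis
    also have "\<dots> \<le> norm (T v) * norm v"
      using ambient.Cauchy_Schwarz[of "T v" v] complex_Re_le_cmod[of "cinner (T v) v"] by simp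
    also have "\<dots> \<le> (c * nrm (T v)) * norm v" using c(2)[OF T_in_V] by (intro mult_right_mono) auto
    finally have le: "nrm (T v) * (k * nrm (T v)) \<le> nrm (T v) * (c * norm v)"
      by (simp add: power2_eq_square mult_ac)
    show "nrm (T v) \<le> c / k * norm v"
    proof (cases "nrm (T v) = 0")
      case False
      then have "nrm (T v) > 0" using nrm_nonneg[OF T_in_V, of v] by linarith
      with le have "k * nrm (T v) \<le> c * norm v" by simp
      then show ?thesis using k by (simp add: field_simps)
    qed (use k c in simp)
  qed
qed

end

context sectorial_form begin

section \<open>The generalized eigenspace\<close>

definition Tshift :: "complex \<Rightarrow> 'a \<Rightarrow> 'a" where "Tshift \<mu> x = T x - \<mu> *\<^sub>C x"

lemma Tshift_linear:
  "(Tshift \<mu> ^^ k) (x + y) = (Tshift \<mu> ^^ k) x + (Tshift \<mu> ^^ k) y"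
  "(Tshift \<mu> ^^ k) (c *\<^sub>C x) = c *\<^sub>C (Tshift \<mu> ^^ k) x"
  "(Tshift \<mu> ^^ k) 0 = 0"
  by (induction k)
    (simp_all add: Tshift_def T_add T_scale T_0 complex_vector.scale_right_distrib
      complex_vector.scale_right_diff_distrib complex_vector.scale_left_commute)

lemma Tshift_T_commute: "(Tshift \<mu> ^^ k) (T x) = T ((Tshift \<mu> ^^ k) x)"
  by (induction k) (simp_all add: Tshift_def T_diff T_scale)

lemma Tshift_zero_add:
  assumes "(Tshift \<mu> ^^ k) x = 0"
  shows "(Tshift \<mu> ^^ (k + j)) x = 0" "(Tshift \<mu> ^^ k) ((Tshift \<mu> ^^ j) x) = 0"
proof -
  show "(Tshift \<mu> ^^ (k + j)) x = 0"
    unfolding add.commute[of k j] funpow_add comp_apply assms by (rule Tshift_linear(3))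
  then show "(Tshift \<mu> ^^ k) ((Tshift \<mu> ^^ j) x) = 0" by (simp add: funpow_add)
qed

text \<open>This relates \<open>T - 1 / lam\<close> to \<open>A - lam\<close> and lets the generalized kernels of the unbounded operator \<open>A\<close>
  be expressed by those of the everywhere defined operator \<open>T\<close>.\<close>

lemma Tshift_eq:
  assumes "lam \<noteq> 0" "x \<in> D"
  shows "Tshift (1 / lam) x = (- 1 / lam) *\<^sub>C T (A x - lam *\<^sub>C x)"
proof -
  have "T (A x - lam *\<^sub>C x) = x - lam *\<^sub>C T x"
    using assms by (simp add: T_diff T_scale T_A)
  then have "(- 1 / lam) *\<^sub>C T (A x - lam *\<^sub>C x) = (- 1 / lam) *\<^sub>C x - (- 1 / lam) *\<^sub>C lam *\<^sub>C T x"
    by (simp only: complex_vector.scale_right_diff_distrib)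
  then show ?thesis using assms(1) by (simp add: Tshift_def)
qed

lemma ker_power_Suc:
  "v \<in> ker_power E L z (Suc k) \<longleftrightarrow> v \<in> E \<and> L v - z *\<^sub>C v \<in> ker_power E L z k"
  unfolding ker_power_def
  by (auto simp: less_Suc_eq_0_disj funpow_Suc_right simp del: funpow.simps)

text \<open>Each factor \<open>A - lam\<close> becomes \<open>T - 1 / lam\<close> at the cost of an injective factor \<open>T\<close>, which commutes
  with everything. For the converse the domain condition must be recovered: if \<open>(T - 1 / lam) v\<close> lies in the
  range of \<open>T\<close>, so does \<open>v / lam\<close>.\<close>

lemma ker_power_iff_Tshift:
  assumes lam: "lam \<noteq> 0"
  shows "v \<in> ker_power D A lam k \<longleftrightarrow> (Tshift (1 / lam) ^^ k) v = 0"
proof (induction k arbitrary: v)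
  case 0
  then show ?case by (simp add: ker_power_def)
next
  case (Suc k)
  let ?S = "Tshift (1 / lam)"
  have step: "(?S ^^ Suc k) v = (- 1 / lam) *\<^sub>C T ((?S ^^ k) (A v - lam *\<^sub>C v))" if "v \<in> D"
    unfolding funpow_Suc_right comp_apply Tshift_eq[OF lam that]
    by (simp only: Tshift_linear(2) Tshift_T_commute)
  show ?case
  proof
    assume "v \<in> ker_power D A lam (Suc k)"
    then show "(?S ^^ Suc k) v = 0"
      using Suc step by (auto simp: ker_power_Suc T_0)
  next
    assume 0: "(?S ^^ Suc k) v = 0"
    then have Sv: "?S v \<in> ker_power D A lam k"
      using Suc by (simp add: funpow_Suc_right del: funpow.simps)
    \<comment> \<open>For \<open>k = 0\<close> membership in the kernel means \<open>?S v = 0\<close>; otherwise it includes \<open>?S v \<in> D\<close>, and \<open>D\<close> is the range of \<open>T\<close>.\<close>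
    have "\<exists>y. ?S v = T y"
    proof (cases k)
      case 0
      then show ?thesis using Sv T_0 by (auto simp: ker_power_def)
    next
      case (Suc k')
      then have "?S v \<in> D" using Sv by (simp add: ker_power_Suc)
      then show ?thesis using T_A by metis
    qed
    then obtain y where y: "?S v = T y" by blast
    have "(1 / lam) *\<^sub>C v = T (v - y)"
      using y by (simp add: Tshift_def T_diff algebra_simps)
    then have "lam *\<^sub>C (1 / lam) *\<^sub>C v = T (lam *\<^sub>C (v - y))" by (simp add: T_scale)
    then have v: "v \<in> D" using lam T_solves(1) by simp metis
    then have "T ((?S ^^ k) (A v - lam *\<^sub>C v)) = 0"
      using step 0 lam by simp
    then have "(?S ^^ k) (A v - lam *\<^sub>C v) = 0" by (rule T_inj)
    then show "v \<in> ker_power D A lam (Suc k)" using Suc v by (simp add: ker_power_Suc)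
  qed
qed

lemma invariant_subspace_iff:
  assumes "lam \<noteq> 0"
  shows "v \<in> invariant_subspace D A lam \<longleftrightarrow> (\<exists>k. (Tshift (1 / lam) ^^ k) v = 0)"
proof
  assume "\<exists>k. (Tshift (1 / lam) ^^ k) v = 0"
  then obtain k where "(Tshift (1 / lam) ^^ k) v = 0" by blast
  then have "(Tshift (1 / lam) ^^ Suc k) v = 0" using Tshift_zero_add(1)[of k _ v 1] by simp
  then have "v \<in> ker_power D A lam (Suc k)" by (simp only: ker_power_iff_Tshift[OF assms])
  then show "v \<in> invariant_subspace D A lam"
    unfolding invariant_subspace_def by (intro UN_I[of "Suc k"]) auto
qed (auto simp: invariant_subspace_def ker_power_iff_Tshift[OF assms])

lemma subspace_invariant_subspace:
  assumes "lam \<noteq> 0"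
  shows "complex_vector.subspace (invariant_subspace D A lam)"
proof (rule complex_vector.subspaceI)
  let ?S = "Tshift (1 / lam)"
  show "0 \<in> invariant_subspace D A lam"
    using invariant_subspace_iff[OF assms] Tshift_linear(3) by blast
  fix x y c
  assume x: "x \<in> invariant_subspace D A lam"
  then show "c *\<^sub>C x \<in> invariant_subspace D A lam"
    unfolding invariant_subspace_iff[OF assms] Tshift_linear(2) by auto
  assume "y \<in> invariant_subspace D A lam"
  then obtain i j where "(?S ^^ i) x = 0" "(?S ^^ j) y = 0"
    using x invariant_subspace_iff[OF assms] by blast
  then have "(?S ^^ (i + j)) (x + y) = 0"
    using Tshift_zero_add(1)[of i _ x j] Tshift_zero_add(1)[of j _ y i]
    by (simp add: Tshift_linear(1) add.commute)
  then show "x + y \<in> invariant_subspace D A lam" using invariant_subspace_iff[OF assms] by blast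
qed

lemma invariant_subspace_in_V: "u \<in> invariant_subspace D A lam \<Longrightarrow> u \<in> V"
  using D_subset_V unfolding invariant_subspace_def ker_power_def by force

text \<open>The Neumann series of \<open>(z - T)\<^sup>-\<^sup>1 u\<close> in powers of \<open>T - \<mu>\<close>, which terminates on the generalized eigenspace.\<close>

definition eigen_resolvent :: "complex \<Rightarrow> nat \<Rightarrow> 'a \<Rightarrow> complex \<Rightarrow> 'a" where
  "eigen_resolvent \<mu> k u z = (\<Sum>j<k. (1 / (z - \<mu>) ^ Suc j) *\<^sub>C (Tshift \<mu> ^^ j) u)"

lemma eigen_resolvent_solves:
  assumes z: "z \<noteq> \<mu>" and u: "(Tshift \<mu> ^^ k) u = 0"
  shows "z *\<^sub>C eigen_resolvent \<mu> k u z - T (eigen_resolvent \<mu> k u z) = u"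
proof -
  let ?w = "eigen_resolvent \<mu> k u z"
  let ?f = "\<lambda>j. (1 / (z - \<mu>) ^ j) *\<^sub>C (Tshift \<mu> ^^ j) u"
  have Tshift_sum: "Tshift \<mu> (\<Sum>j\<in>J. c j *\<^sub>C g j) = (\<Sum>j\<in>J. c j *\<^sub>C Tshift \<mu> (g j))"
    for J :: "nat set" and c g
    using Tshift_linear[where k = 1] by (induction J rule: infinite_finite_induct) auto
  have "z *\<^sub>C ?w - T ?w = (z - \<mu>) *\<^sub>C ?w - Tshift \<mu> ?w"
    by (simp add: Tshift_def complex_vector.scale_left_diff_distrib)
  also have "(z - \<mu>) *\<^sub>C ?w = (\<Sum>j<k. ?f j)"
    using z by (simp add: eigen_resolvent_def complex_vector.scale_sum_right)
  also have "Tshift \<mu> ?w = (\<Sum>j<k. ?f (Suc j))"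
    by (simp add: eigen_resolvent_def Tshift_sum)
  also have "(\<Sum>j<k. ?f j) - (\<Sum>j<k. ?f (Suc j)) = ?f 0 - ?f k"
    unfolding sum_subtractf[symmetric] by (rule sum_lessThan_telescope')
  finally show ?thesis using u by simp
qed

lemma eigen_resolvent_in_invariant_subspace:
  assumes lam: "lam \<noteq> 0" and u: "(Tshift (1 / lam) ^^ k) u = 0"
  shows "eigen_resolvent (1 / lam) k u z \<in> invariant_subspace D A lam"
proof -
  have "(Tshift (1 / lam) ^^ k) ((Tshift (1 / lam) ^^ j) u) = 0" for j
    using u by (rule Tshift_zero_add(2))
  then show ?thesis
    unfolding eigen_resolvent_def using invariant_subspace_iff[OF lam] subspace_invariant_subspace[OF lam]
    by (intro complex_vector.subspace_sum complex_vector.subspace_scale) blast+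
qed

end

section \<open>Resolvent bounds\<close>

text \<open>A lower bound at \<open>c\<close> with constant \<open>K\<close> persists with constant \<open>2 K\<close> on the disc of radius \<open>1 / (2 K)\<close>
  around \<open>c\<close>; finitely many such discs cover \<open>Z\<close>.\<close>

lemma resolvent_bound_on_compact:
  assumes Z: "compact Z" "Z \<inter> op_spectrum UNIV UNIV L = {}"
  obtains K where "K > 0" "\<And>z x. z \<in> Z \<Longrightarrow> norm x \<le> K * norm (z *\<^sub>C x - L x)"
proof -
  have "\<exists>K>0. \<forall>x. norm x \<le> K * norm (z *\<^sub>C x - L x)" if z: "z \<in> Z" for z
  proof -
    obtain K where K: "\<And>x. norm x \<le> K * norm (z *\<^sub>C x - L x)"
      using z Z(2) unfolding op_spectrum_def by blast
    have "norm x \<le> max K 1 * norm (z *\<^sub>C x - L x)" for x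
      using K[of x] mult_right_mono[of K "max K 1" "norm (z *\<^sub>C x - L x)"] by simp
    then show ?thesis by (intro exI[of _ "max K 1"]) simp
  qed
  then obtain K where K: "\<And>z. z \<in> Z \<Longrightarrow> K z > 0"
    "\<And>z x. z \<in> Z \<Longrightarrow> norm x \<le> K z * norm (z *\<^sub>C x - L x)" by metis
  have nearby: "norm x \<le> 2 * K c * norm (z *\<^sub>C x - L x)"
    if c: "c \<in> Z" and z: "z \<in> ball c (1 / (2 * K c))" for c z x
  proof -
    have split: "c *\<^sub>C x - L x = (z *\<^sub>C x - L x) + (c - z) *\<^sub>C x"
      by (simp add: complex_vector.scale_left_diff_distrib)
    have "norm (c *\<^sub>C x - L x) \<le> norm (z *\<^sub>C x - L x) + cmod (c - z) * norm x"
      unfolding split using norm_triangle_ineq[of "z *\<^sub>C x - L x" "(c - z) *\<^sub>C x"] ambient.nrm_scale[of x "c - z"] by simp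
    moreover have "cmod (c - z) * norm x \<le> 1 / (2 * K c) * norm x"
      using z by (intro mult_right_mono) (auto simp: dist_norm)
    ultimately have "K c * norm (c *\<^sub>C x - L x) \<le> K c * (norm (z *\<^sub>C x - L x) + 1 / (2 * K c) * norm x)"
      using K(1)[OF c] by (intro mult_left_mono) auto
    also have "\<dots> = K c * norm (z *\<^sub>C x - L x) + norm x / 2"
      using K(1)[OF c] by (simp add: field_simps)
    finally show ?thesis using K(2)[OF c, of x] by linarith
  qed
  have "Z \<subseteq> (\<Union>c\<in>Z. ball c (1 / (2 * K c)))" using K(1) by force
  then obtain F where F: "F \<subseteq> Z" "finite F" "Z \<subseteq> (\<Union>c\<in>F. ball c (1 / (2 * K c)))"
    using compactE_image[OF Z(1), of Z "\<lambda>c. ball c (1 / (2 * K c))"] open_ball by metis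
  let ?K = "1 + (\<Sum>c\<in>F. 2 * K c)"
  have nn: "0 \<le> 2 * K c" if "c \<in> F" for c using K(1)[of c] F(1) that by auto
  show ?thesis
  proof
    show "?K > 0" using sum_nonneg[of F "\<lambda>c. 2 * K c", OF nn] by linarith
    fix z x assume "z \<in> Z"
    then obtain c where c: "c \<in> F" "z \<in> ball c (1 / (2 * K c))" using F(3) by blast
    then have "norm x \<le> 2 * K c * norm (z *\<^sub>C x - L x)" using nearby F(1) by blast
    also have "\<dots> \<le> ?K * norm (z *\<^sub>C x - L x)"
      using member_le_sum[of c F "\<lambda>c. 2 * K c"] nn c(1) F(2) by (intro mult_right_mono) auto
    finally show "norm x \<le> ?K * norm (z *\<^sub>C x - L x)" .
  qed
qed

context sectorial_form begin

lemma T_bounded_nrm: obtains \<tau> where "\<tau> > 0" "\<And>v. v \<in> V \<Longrightarrow> nrm (T v) \<le> \<tau> * nrm v"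
proof -
  obtain c where c: "c > 0" "\<And>v. nrm (T v) \<le> c * norm v" using T_bounded by blast
  obtain d where d: "d > 0" "\<And>v. v \<in> V \<Longrightarrow> norm v \<le> d * nrm v" using norm_le_nrm by blast
  show ?thesis
  proof
    show "c * d > 0" using c d by simp
    show "nrm (T v) \<le> c * d * nrm v" if "v \<in> V" for v
      using c(2)[of v] mult_left_mono[OF d(2)[OF that], of c] c(1) by (simp only: mult.assoc) linarith
  qed
qed

text \<open>From \<open>z y = v + T y\<close> with \<open>v = z y - T y\<close>, the norm of \<open>y\<close> in \<open>V\<close> is controlled by that of \<open>v\<close> and of \<open>T y\<close>;
  the latter only involves the ambient norm of \<open>y\<close>, to which the resolvent bound in the ambient space applies.\<close>

lemma resolvent_bound_nrm:
  assumes Z: "compact Z" "Z \<inter> op_spectrum UNIV UNIV T = {}" "0 \<notin> Z"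
  obtains \<kappa> where "\<kappa> > 0" "\<And>z y. z \<in> Z \<Longrightarrow> y \<in> V \<Longrightarrow> nrm y \<le> \<kappa> * nrm (z *\<^sub>C y - T y)"
proof -
  obtain c where c: "c > 0" "\<And>v. nrm (T v) \<le> c * norm v" using T_bounded by blast
  obtain d where d: "d > 0" "\<And>v. v \<in> V \<Longrightarrow> norm v \<le> d * nrm v" using norm_le_nrm by blast
  obtain K where K: "K > 0" "\<And>z x. z \<in> Z \<Longrightarrow> norm x \<le> K * norm (z *\<^sub>C x - T x)"
    using resolvent_bound_on_compact[OF Z(1,2)] by blast
  obtain \<rho> where \<rho>: "\<rho> > 0" "\<And>z. z \<in> Z \<Longrightarrow> \<rho> \<le> cmod z"
    using separate_point_closed[OF compact_imp_closed[OF Z(1)] Z(3)] by auto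
  show ?thesis
  proof
    show "(1 + c * K * d) / \<rho> > 0" using c d K \<rho> by (simp add: add_pos_pos)
    fix z y assume z: "z \<in> Z" and y: "y \<in> V"
    define v where "v = z *\<^sub>C y - T y"
    have v: "v \<in> V" unfolding v_def using y V_closed T_in_V by auto
    have "norm y \<le> K * (d * nrm v)"
      using K(2)[OF z, of y] mult_left_mono[OF d(2)[OF v], of K] K(1) unfolding v_def by linarith
    then have "c * norm y \<le> c * (K * (d * nrm v))" using c(1) by (intro mult_left_mono) auto
    then have Ty: "nrm (T y) \<le> c * K * d * nrm v" using c(2)[of y] by (simp add: mult_ac)
    have "\<rho> * nrm y \<le> cmod z * nrm y" using \<rho>(2)[OF z] nrm_nonneg[OF y] by (rule mult_right_mono)
    also have "\<dots> = nrm (v + T y)" using nrm_scale[OF y] unfolding v_def by simp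
    also have "\<dots> \<le> nrm v + nrm (T y)" by (rule nrm_triangle[OF v T_in_V])
    finally have "\<rho> * nrm y \<le> (1 + c * K * d) * nrm v" using Ty by (simp add: algebra_simps)
    then show "nrm y \<le> (1 + c * K * d) / \<rho> * nrm (z *\<^sub>C y - T y)"
      unfolding v_def[symmetric] using \<rho>(1) by (simp add: field_simps)
  qed
qed

text \<open>The real-valued supremum in the gap bounds its members because the infima are at most \<open>1\<close>, as the choice \<open>y = 0\<close>
  shows. The vector \<open>x = 0\<close>, over which the supremum does not range, is approximated by itself.\<close>

lemma operator_gap_approximant:
  assumes S: "S \<subseteq> V" and L: "L ` S \<subseteq> V" "L 0 = 0"
    and gap: "operator_gap nrm S L V T < \<delta>" and x: "x \<in> S"
  obtains y where "y \<in> V" "nrm (x - y) + nrm (L x - T y) \<le> \<delta> * (nrm x + nrm (L x))"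
proof (cases "x = 0")
  case True
  then show ?thesis using that[of 0] V_closed(1) L(2) T_0 nrm_0 by simp
next
  case False
  define q where "q x y = (nrm (x - y) + nrm (L x - T y)) / (nrm x + nrm (L x))" for x y
  have q0: "0 \<le> q x y" if "x \<in> S" "y \<in> V" for x y
    unfolding q_def using that S L V_closed T_in_V
    by (intro divide_nonneg_nonneg add_nonneg_nonneg nrm_nonneg) auto
  have pos: "nrm x + nrm (L x) > 0" if "x \<in> S" "x \<noteq> 0" for x
    using that S L nrm_eq_0[of x] nrm_nonneg[of x] nrm_nonneg[of "L x"] by (auto simp: subset_iff image_subset_iff less_le add_nonneg_eq_0_iff)
  have bddb: "bdd_below (q x ` V)" if "x \<in> S" for x
    using q0[OF that] by (auto intro!: bdd_belowI2)
  have "(INF y\<in>V. q x y) \<le> 1" if "x \<in> S - {0}" for x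
    using cINF_lower[OF bddb V_closed(1), of x] that pos[of x] by (simp add: q_def T_0)
  then have bdda: "bdd_above ((\<lambda>x. INF y\<in>V. q x y) ` (S - {0}))" by (auto intro!: bdd_aboveI2)
  have "(INF y\<in>V. q x y) < \<delta>"
    using cSUP_upper[OF _ bdda, of x] x False gap unfolding operator_gap_def q_def by auto
  then obtain y where y: "y \<in> V" "q x y < \<delta>"
    using cINF_less_iff[OF _ bddb[OF x], of \<delta>] V_closed(1) by auto
  then show ?thesis
    using that[OF y(1)] pos[OF x False] unfolding q_def by (simp add: pos_divide_less_eq)
qed

text \<open>Let \<open>(y, T y)\<close> be close to \<open>(x, L x)\<close>, with \<open>p = nrm x + nrm (L x)\<close>. The lower bound for \<open>z - T\<close> at \<open>y\<close> gives
  \<open>p \<le> m * nrm (z x - L x) + \<delta> (m b + 1) p\<close>, where \<open>b\<close> bounds \<open>cmod z\<close> and \<open>1\<close>, and \<open>m\<close> is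
  built from the resolvent bound and the norm of \<open>T\<close> on \<open>V\<close>; the last term is absorbed by the
  left-hand side when \<open>\<delta> (m b + 1) = 1 / 2\<close>.\<close>

lemma discrete_stability:
  assumes Z: "compact Z" "Z \<inter> op_spectrum UNIV UNIV T = {}" "0 \<notin> Z"
  obtains \<delta> C where "\<delta> > 0" "C > 0"
    "\<And>S L z x. S \<subseteq> V \<Longrightarrow> L ` S \<subseteq> V \<Longrightarrow> L 0 = 0 \<Longrightarrow> operator_gap nrm S L V T < \<delta> \<Longrightarrow>
      z \<in> Z \<Longrightarrow> x \<in> S \<Longrightarrow> nrm x \<le> C * nrm (z *\<^sub>C x - L x)"
proof -
  obtain \<tau> where \<tau>: "\<tau> > 0" "\<And>v. v \<in> V \<Longrightarrow> nrm (T v) \<le> \<tau> * nrm v" using T_bounded_nrm by blast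
  obtain \<kappa> where \<kappa>: "\<kappa> > 0" "\<And>z y. z \<in> Z \<Longrightarrow> y \<in> V \<Longrightarrow> nrm y \<le> \<kappa> * nrm (z *\<^sub>C y - T y)"
    using resolvent_bound_nrm[OF Z] by blast
  obtain b0 where b0: "\<And>z. z \<in> Z \<Longrightarrow> cmod z \<le> b0"
    using compact_imp_bounded[OF Z(1)] unfolding bounded_iff by blast
  define b where "b = max 1 b0"
  have b: "1 \<le> b" "\<And>z. z \<in> Z \<Longrightarrow> cmod z \<le> b" using b0 by (auto simp: b_def intro: max.coboundedI2)
  define m where "m = (1 + \<tau>) * \<kappa>"
  have m: "m > 0" using \<tau> \<kappa> by (simp add: m_def)
  define \<delta> where "\<delta> = 1 / (2 * (m * b + 1))"
  have mb: "m * b + 1 > 0" using m b(1) by (simp add: add_pos_pos)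
  then have \<delta>: "\<delta> > 0" "\<delta> * (m * b + 1) = 1 / 2" by (auto simp: \<delta>_def)
  show ?thesis
  proof
    show "\<delta> > 0" by (rule \<delta>)
    show "2 * m > 0" using m by simp
    fix S L z x
    assume S: "S \<subseteq> V" and L: "L ` S \<subseteq> V" "L 0 = 0" and gap: "operator_gap nrm S L V T < \<delta>"
      and z: "z \<in> Z" and x: "x \<in> S"
    obtain y where y: "y \<in> V" "nrm (x - y) + nrm (L x - T y) \<le> \<delta> * (nrm x + nrm (L x))"
      using operator_gap_approximant[OF S L gap x] by blast
    have xV: "x \<in> V" and LV: "L x \<in> V" using S L x by auto
    define p where "p = nrm x + nrm (L x)"
    define e where "e = nrm (z *\<^sub>C x - L x)"
    have split: "z *\<^sub>C y - T y = (z *\<^sub>C x - L x) + (z *\<^sub>C (y - x) + (L x - T y))"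
      by (simp add: complex_vector.scale_right_diff_distrib)
    have "nrm (z *\<^sub>C y - T y) \<le> e + (cmod z * nrm (x - y) + nrm (L x - T y))"
      unfolding split using nrm_triangle[of "z *\<^sub>C x - L x" "z *\<^sub>C (y - x) + (L x - T y)"]
        nrm_triangle[of "z *\<^sub>C (y - x)" "L x - T y"] nrm_scale[of "y - x" z]
        nrm_minus_commute[OF xV y(1)] xV LV y(1) V_closed T_in_V unfolding e_def by simp
    moreover have "cmod z * nrm (x - y) \<le> b * nrm (x - y)"
      using b(2)[OF z] nrm_nonneg V_closed xV y(1) by (intro mult_right_mono) auto
    moreover have "nrm (L x - T y) \<le> b * nrm (L x - T y)"
      using b(1) mult_right_mono[of 1 b "nrm (L x - T y)"] nrm_nonneg V_closed LV T_in_V by simp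
    moreover have "b * nrm (x - y) + b * nrm (L x - T y) \<le> b * (\<delta> * p)"
      using mult_left_mono[OF y(2), of b] b(1) by (simp add: p_def algebra_simps)
    ultimately have "nrm (z *\<^sub>C y - T y) \<le> e + b * (\<delta> * p)" by linarith
    then have "\<kappa> * nrm (z *\<^sub>C y - T y) \<le> \<kappa> * (e + b * (\<delta> * p))"
      using \<kappa>(1) by (intro mult_left_mono) auto
    then have ny: "nrm y \<le> \<kappa> * (e + b * (\<delta> * p))" using \<kappa>(2)[OF z y(1)] by linarith
    have "nrm x \<le> nrm y + nrm (x - y)" "nrm (L x) \<le> nrm (T y) + nrm (L x - T y)"
      using nrm_triangle[of y "x - y"] nrm_triangle[of "T y" "L x - T y"] xV LV y(1) T_in_V V_closed by auto
    then have "p \<le> nrm y + \<tau> * nrm y + \<delta> * p"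
      using y(2) \<tau>(2)[OF y(1)] unfolding p_def by linarith
    also have "\<dots> = (1 + \<tau>) * nrm y + \<delta> * p" by (simp add: algebra_simps)
    also have "\<dots> \<le> (1 + \<tau>) * (\<kappa> * (e + b * (\<delta> * p))) + \<delta> * p"
      using ny \<tau>(1) by (intro add_right_mono mult_left_mono) auto
    also have "\<dots> = m * e + (\<delta> * (m * b + 1)) * p" by (simp add: m_def algebra_simps)
    also have "\<dots> = m * e + p / 2" by (simp add: \<delta>(2))
    finally have "p \<le> 2 * m * e" by simp
    then show "nrm x \<le> 2 * m * nrm (z *\<^sub>C x - L x)"
      using nrm_nonneg[OF LV] unfolding p_def e_def by linarith
  qed
qed

end

section \<open>Integrals with values in a finite-dimensional subspace\<close>

lemma bounded_linear_scaleC_left: "bounded_linear (\<lambda>c. c *\<^sub>C (x :: 'h::chilbert_space))"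
proof (rule bounded_linear_intro[where K = "norm x"])
  fix c d :: complex and r :: real
  show "(c + d) *\<^sub>C x = c *\<^sub>C x + d *\<^sub>C x" by (rule scaleC_add_left)
  show "(r *\<^sub>R c) *\<^sub>C x = r *\<^sub>R (c *\<^sub>C x)" by (simp add: scaleR_scaleC scaleR_conv_of_real)
  show "norm (c *\<^sub>C x) \<le> norm c * norm x" using ambient.nrm_scale[of x c] by simp
qed

lemma continuous_on_scaleC:
  fixes x :: "'t::topological_space \<Rightarrow> 'h::chilbert_space"
  assumes "continuous_on S c" "continuous_on S x"
  shows "continuous_on S (\<lambda>t. c t *\<^sub>C x t)"
proof -
  have "bounded_bilinear (\<lambda>(c :: complex) (x :: 'h). c *\<^sub>C x)"
  proof
    show "\<exists>K. \<forall>c (x :: 'h). norm (c *\<^sub>C x) \<le> norm c * norm x * K"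
      by (intro exI[of _ 1]) (simp add: ambient.nrm_scale)
  qed (simp_all add: scaleC_add_left scaleC_add_right scaleR_scaleC scaleR_conv_of_real mult.commute)
  from bounded_bilinear.continuous_on[OF this assms] show ?thesis .
qed

text \<open>The coordinates with respect to \<open>d\<close> are inner products of the ambient space, hence continuous there. This
  makes the norm of \<open>V\<close> comparable with the ambient norm on \<open>S\<close>, and lets coordinates commute with integration.\<close>

lemma finite_dimensional_expansion:
  assumes S: "has_cdim S n"
  obtains B d where "finite B" "\<And>b. b \<in> B \<Longrightarrow> d b \<in> S"
    "\<And>x. x \<in> S \<Longrightarrow> x = (\<Sum>b\<in>B. cinner b x *\<^sub>C d b)"
proof -
  have nd: "\<forall>u\<in>S. (\<forall>v\<in>S. cinner u v = 0) \<longrightarrow> u = 0"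
  proof (intro ballI impI)
    fix u assume "u \<in> S" "\<forall>v\<in>S. cinner u v = 0"
    then show "u = 0" using ambient.ip_pos[of u] by (cases "u = 0") auto
  qed
  obtain B d where B: "finite B" "B \<subseteq> S" "\<forall>b\<in>B. d b \<in> S"
    "\<forall>v\<in>UNIV. \<forall>p. p \<in> S \<and> (\<forall>u\<in>S. cinner u (v - p) = 0) \<longleftrightarrow> p = (\<Sum>b\<in>B. cinner b v *\<^sub>C d b)"
    using oblique_projection_expansion[OF ambient.sesquilinear complex_vector.subspace_UNIV
        subset_UNIV subset_UNIV S S nd] by (elim exE conjE) (rule that)
  have "x = (\<Sum>b\<in>B. cinner b x *\<^sub>C d b)" if "x \<in> S" for x
    by (rule B(4)[rule_format, THEN iffD1]) (simp_all add: that ambient.ip_zero)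
  then show ?thesis using that[of B d] B(1,3) by blast
qed

text \<open>Cauchy's formula for the derivatives of the constant function \<open>1\<close>.\<close>

lemma has_integral_circlepath_power:
  fixes r :: real
  assumes "r > 0"
  shows "((\<lambda>t. vector_derivative (circlepath \<mu> r) (at t within {0..1}) * (1 / (circlepath \<mu> r t - \<mu>) ^ Suc j))
    has_integral (if j = 0 then 2 * of_real pi * \<i> else 0)) {0..1}"
proof -
  have "((\<lambda>u. 1 / (u - \<mu>) ^ Suc j) has_contour_integral
      (2 * pi * \<i>) / fact j * (deriv ^^ j) (\<lambda>_. 1) \<mu>) (circlepath \<mu> r)"
    using assms by (intro Cauchy_has_contour_integral_higher_derivative_circlepath) auto
  then show ?thesis
    unfolding has_contour_integral_def by (simp add: higher_deriv_const mult.commute split: if_splits)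
qed

context ip_space begin

lemma finite_dimensional_norm_bound:
  assumes S: "S \<subseteq> V" "has_cdim S n"
  obtains c where "\<And>x. x \<in> S \<Longrightarrow> nrm x \<le> c * norm x"
proof -
  obtain B d where B: "finite B" "\<And>b. b \<in> B \<Longrightarrow> d b \<in> S"
    "\<And>x. x \<in> S \<Longrightarrow> x = (\<Sum>b\<in>B. cinner b x *\<^sub>C d b)"
    using finite_dimensional_expansion[OF S(2)] by blast
  show ?thesis
  proof
    fix x assume x: "x \<in> S"
    have "nrm (\<Sum>b\<in>B. cinner b x *\<^sub>C d b) \<le> (\<Sum>b\<in>B. (norm b * norm x) * nrm (d b))"
      using B(2) S(1) ambient.Cauchy_Schwarz by (intro nrm_sum_scale) auto
    also have "\<dots> = (\<Sum>b\<in>B. norm b * nrm (d b)) * norm x"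
      by (simp add: sum_distrib_left sum_distrib_right mult_ac)
    finally show "nrm x \<le> (\<Sum>b\<in>B. norm b * nrm (d b)) * norm x" using B(3)[OF x] by simp
  qed
qed

text \<open>The integral is taken with respect to the ambient norm, whereas the estimate concerns the norm of \<open>V\<close>. On \<open>S\<close> both
  the identity and the functional \<open>ip I\<close> agree with maps \<open>Q\<close> and \<open>l\<close> that are continuous on the whole ambient space and
  so commute with integration; the bound follows from \<open>(nrm I)\<^sup>2 = ip I I = integral {0..1} (\<lambda>t. l (F t))\<close>.\<close>

lemma integral_in_finite_dimensional_subspace:
  assumes S: "S \<subseteq> V" "has_cdim S n" and F: "(F has_integral I) {0..1::real}"
    and FS: "\<And>t. t \<in> {0..1} \<Longrightarrow> F t \<in> S" and bound: "\<And>t. t \<in> {0..1} \<Longrightarrow> nrm (F t) \<le> K"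
  shows "I \<in> S" "nrm I \<le> K"
proof -
  obtain B d where B: "finite B" "\<And>b. b \<in> B \<Longrightarrow> d b \<in> S"
    "\<And>x. x \<in> S \<Longrightarrow> x = (\<Sum>b\<in>B. cinner b x *\<^sub>C d b)"
    using finite_dimensional_expansion[OF S(2)] by blast
  define Q where "Q x = (\<Sum>b\<in>B. cinner b x *\<^sub>C d b)" for x
  have "bounded_linear Q"
    unfolding Q_def
    by (intro bounded_linear_sum bounded_linear_compose[OF bounded_linear_scaleC_left bounded_linear_cinner_right])
  from has_integral_linear[OF F this] have "((\<lambda>t. Q (F t)) has_integral Q I) {0..1}"
    by (simp add: comp_def)
  moreover have "Q (F t) = F t" if "t \<in> {0..1}" for t
    using B(3)[OF FS[OF that]] by (simp add: Q_def)
  ultimately have "(F has_integral Q I) {0..1}"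
    by (rule has_integral_eq[rotated])
  then have IQ: "I = Q I" using F has_integral_unique by blast
  moreover have "Q I \<in> S"
    unfolding Q_def using B(2) has_cdim_subspace[OF S(2)]
    by (intro complex_vector.subspace_sum complex_vector.subspace_scale) auto
  ultimately show IS: "I \<in> S" by simp
  have IV: "I \<in> V" using IS S by blast
  define l where "l x = (\<Sum>b\<in>B. cinner b x * ip I (d b))" for x
  have l: "l x = ip I x" if x: "x \<in> S" for x
  proof -
    have "ip I x = ip I (\<Sum>b\<in>B. cinner b x *\<^sub>C d b)" using B(3)[OF x] by simp
    also have "\<dots> = l x"
      unfolding l_def using B(2) S(1)
      by (intro linear_on_sum[OF sesquilinear_on_linear_on[OF sesquilinear subset_refl IV] subspace_V]) auto
    finally show ?thesis by simp
  qed
  have "bounded_linear l"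
    unfolding l_def
    by (intro bounded_linear_sum bounded_linear_compose[OF bounded_linear_mult_left bounded_linear_cinner_right])
  from has_integral_linear[OF F this] have li: "((\<lambda>t. l (F t)) has_integral ip I I) {0..1}"
    by (simp add: comp_def l[OF IS])
  have K0: "0 \<le> K" using bound[of 0] nrm_nonneg[of "F 0"] FS[of 0] S(1) by auto
  have "cmod (l (F t)) \<le> nrm I * K" if t: "t \<in> {0..1}" for t
  proof -
    have "cmod (ip I (F t)) \<le> nrm I * nrm (F t)"
      using Cauchy_Schwarz[OF IV, of "F t"] FS[OF t] S(1) by auto
    also have "\<dots> \<le> nrm I * K" using bound[OF t] nrm_nonneg[OF IV] by (rule mult_left_mono)
    finally show ?thesis using l[OF FS[OF t]] by simp
  qed
  then have "cmod (ip I I) \<le> nrm I * K"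
    using has_integral_bound_real[OF _ _ li, of "nrm I * K" "{}"] K0 nrm_nonneg[OF IV] by auto
  then have le: "nrm I * nrm I \<le> nrm I * K"
    using ip_self[OF IV] by (simp add: power2_eq_square norm_mult)
  show "nrm I \<le> K"
    using le K0 nrm_nonneg[OF IV] by (cases "nrm I = 0") auto
qed

section \<open>Orthogonal projections and the subspace gap\<close>

text \<open>Pythagoras for \<open>v - y = (v - p) + (p - y)\<close>, with \<open>p\<close> the projection of \<open>v\<close>.\<close>

lemma orth_projection_best:
  assumes S: "S \<subseteq> V" "has_cdim S n" and v: "v \<in> V"
  shows "orth_projection ip S v \<in> S"
    "\<And>y. y \<in> S \<Longrightarrow> nrm (v - orth_projection ip S v) \<le> nrm (v - y)"
proof -
  have nd: "\<forall>u\<in>S. (\<forall>v\<in>S. ip u v = 0) \<longrightarrow> u = 0"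
  proof (intro ballI impI)
    fix u assume "u \<in> S" "\<forall>v\<in>S. ip u v = 0"
    then show "u = 0" using ip_pos[of u] S(1) by (cases "u = 0") auto
  qed
  obtain B d where "finite B" "B \<subseteq> S" "\<forall>b\<in>B. d b \<in> S" and
    B: "\<forall>v\<in>V. \<forall>p. p \<in> S \<and> (\<forall>u\<in>S. ip u (v - p) = 0) \<longleftrightarrow> p = (\<Sum>b\<in>B. ip b v *\<^sub>C d b)"
    using oblique_projection_expansion[OF sesquilinear subspace_V S(1) S(1) S(2) S(2) nd]
    by (elim exE conjE) (rule that)
  define p where "p = orth_projection ip S v"
  have "p \<in> S \<and> (\<forall>u\<in>S. ip u (v - p) = 0)"
    unfolding B[rule_format, OF v] p_def oblique_projection_def by (rule the_equality) auto
  then have p: "p \<in> S" "\<forall>u\<in>S. ip u (v - p) = 0" by auto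
  show "orth_projection ip S v \<in> S" using p(1) by (simp add: p_def)
  fix y assume y: "y \<in> S"
  have pV: "p \<in> V" "y \<in> V" using p y S by auto
  have "ip (p - y) (v - p) = 0"
    using p(2) complex_vector.subspace_diff[OF has_cdim_subspace[OF S(2)] p(1) y] by blast
  then have "(nrm (v - y))\<^sup>2 = (nrm (v - p))\<^sup>2 + (nrm (p - y))\<^sup>2"
    using nrm_square_shift[of "v - p" "p - y" 1] pV v V_closed by simp
  then have "(nrm (v - p))\<^sup>2 \<le> (nrm (v - y))\<^sup>2" by simp
  then show "nrm (v - orth_projection ip S v) \<le> nrm (v - y)"
    unfolding p_def[symmetric] using nrm_nonneg pV v V_closed by (simp add: power2_le_iff_abs_le)
qed

text \<open>The projection is the best approximation, so its error is at most each distance in the definition of the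
  gap; the supremum there is over numbers bounded by \<open>1\<close>, because \<open>y = 0\<close> competes.\<close>

lemma distance_le_subspace_gap:
  assumes S: "S \<subseteq> V" "has_cdim S n" and U: "U \<subseteq> V" "x \<in> U"
  shows "nrm (x - orth_projection ip S x) \<le> subspace_gap nrm U S * nrm x"
proof (cases "x = 0")
  case True
  then show ?thesis
    using orth_projection_best(2)[OF S V_closed(1), of 0]
      complex_vector.subspace_0[OF has_cdim_subspace[OF S(2)]] nrm_0 by simp
next
  case False
  note S0 = complex_vector.subspace_0[OF has_cdim_subspace[OF S(2)]]
  have pos: "nrm y > 0" if "y \<in> U - {0}" for y
    using that U nrm_eq_0[of y] nrm_nonneg[of y] by (auto simp: less_le)
  have bddb: "bdd_below ((\<lambda>y. nrm (y - v) / nrm v) ` S)" if "v \<in> U - {0}" for v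
    using pos[OF that] that U S
    by (intro bdd_belowI2[of _ 0] divide_nonneg_pos nrm_nonneg V_closed(3)) auto
  have "(INF y\<in>S. nrm (y - v) / nrm v) \<le> 1" if v: "v \<in> U - {0}" for v
  proof -
    have "(INF y\<in>S. nrm (y - v) / nrm v) \<le> nrm (0 - v) / nrm v"
      by (rule cINF_lower[OF bddb[OF v] S0])
    then show ?thesis
      using nrm_minus_commute[of 0 v] V_closed(1) v U pos[OF v] by auto
  qed
  then have bdda: "bdd_above ((\<lambda>v. INF y\<in>S. nrm (y - v) / nrm v) ` (U - {0}))" by (rule bdd_aboveI2)
  have x: "x \<in> U - {0}" and xV: "x \<in> V" using False U by auto
  have "nrm (x - orth_projection ip S x) / nrm x \<le> (INF y\<in>S. nrm (y - x) / nrm x)"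
  proof (rule cINF_greatest)
    show "S \<noteq> {}" using S0 by blast
    show "nrm (x - orth_projection ip S x) / nrm x \<le> nrm (y - x) / nrm x" if "y \<in> S" for y
      using orth_projection_best(2)[OF S xV that] nrm_minus_commute[OF xV, of y] that S pos[OF x]
      by (intro divide_right_mono) auto
  qed
  also have "\<dots> \<le> subspace_gap nrm U S"
    unfolding subspace_gap_def by (rule cSUP_upper[OF x bdda])
  finally show ?thesis using pos[OF x] by (simp add: field_simps)
qed

end

section \<open>The Petrov-Galerkin operator\<close>

locale petrov_galerkin = sectorial_form +
  fixes S1 S2 :: "'a set" and n :: nat
  assumes S1_V: "S1 \<subseteq> V" and S2_V: "S2 \<subseteq> V"
    and dim: "has_cdim S1 n" "has_cdim S2 n" "n \<ge> 1"
    and inf_sup_pos: "inf_sup nrm a S1 S2 > 0"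
begin

abbreviation P :: "'a \<Rightarrow> 'a" where "P \<equiv> oblique_projection a S1 S2"
abbreviation Th :: "'a \<Rightarrow> 'a" where "Th \<equiv> discrete_inv V a S1 S2"

lemmas S1_subspace = has_cdim_subspace[OF dim(1)] and S2_subspace = has_cdim_subspace[OF dim(2)]

lemma S1_closed:
  "0 \<in> S1" "x \<in> S1 \<Longrightarrow> y \<in> S1 \<Longrightarrow> x + y \<in> S1" "x \<in> S1 \<Longrightarrow> y \<in> S1 \<Longrightarrow> x - y \<in> S1"
  "x \<in> S1 \<Longrightarrow> c *\<^sub>C x \<in> S1"
  using S1_subspace complex_vector.subspace_0 complex_vector.subspace_add
    complex_vector.subspace_diff complex_vector.subspace_scale by blast+

lemma S1_unit_vector: obtains v where "v \<in> S1" "nrm v = 1"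
proof -
  obtain B where B: "finite B" "card B = n" "complex_vector.independent B" "complex_vector.span B = S1"
    using dim(1) unfolding has_cdim_def by blast
  then obtain b where "b \<in> B" using dim(3) by fastforce
  then have "b \<noteq> 0" "b \<in> S1"
    using B complex_vector.dependent_zero complex_vector.span_base by blast+
  then show ?thesis using that[of "of_real (1 / nrm b) *\<^sub>C b"] S1_closed(4) normalize S1_V by auto
qed

text \<open>A vector of \<open>S2\<close> violating this could be normalized, and would make the infimum in the inf-sup constant vanish.\<close>

lemma nondegenerate:
  "\<forall>u\<in>S2. (\<forall>v\<in>S1. a u v = 0) \<longrightarrow> u = 0"
proof (intro ballI impI, rule ccontr)
  fix u assume u: "u \<in> S2" "\<forall>v\<in>S1. a u v = 0" and "u \<noteq> 0"
  define E where "E = {v\<in>S1. nrm v = 1}"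
  define f where "f u = (SUP v\<in>E. cmod (a u v))" for u
  define u' where "u' = of_real (1 / nrm u) *\<^sub>C u"
  have uV: "u \<in> V" using u(1) S2_V by blast
  have u': "u' \<in> S2" "nrm u' = 1"
    unfolding u'_def
    by (rule complex_vector.subspace_scale[OF S2_subspace u(1)], rule normalize[OF uV \<open>u \<noteq> 0\<close>])
  obtain e where e: "e \<in> E" unfolding E_def by (rule S1_unit_vector) auto
  obtain C where C: "\<And>u v. u \<in> V \<Longrightarrow> v \<in> V \<Longrightarrow> cmod (a u v) \<le> C * nrm u * nrm v"
    using a_bounded by metis
  have "0 \<le> f x" if "x \<in> S2" "nrm x = 1" for x
  proof -
    have "cmod (a x v) \<le> C" if "v \<in> E" for v
    proof -
      have "x \<in> V" "v \<in> V" "nrm v = 1" using that \<open>x \<in> S2\<close> S1_V S2_V unfolding E_def by auto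
      then show ?thesis using C[of x v] \<open>nrm x = 1\<close> by simp
    qed
    then have "bdd_above ((\<lambda>v. cmod (a x v)) ` E)" by (rule bdd_aboveI2)
    from cSUP_upper[OF e this] show ?thesis unfolding f_def using norm_ge_zero[of "a x e"] by linarith
  qed
  then have "bdd_below (f ` {x\<in>S2. nrm x = 1})" by (intro bdd_belowI2[of _ 0]) blast
  moreover have "u' \<in> {x\<in>S2. nrm x = 1}" using u' by blast
  ultimately have "(INF x\<in>{x\<in>S2. nrm x = 1}. f x) \<le> f u'" by (rule cINF_lower)
  moreover have "f u' = 0"
  proof -
    have "a u' v = 0" if "v \<in> E" for v
    proof -
      have "v \<in> S1" "v \<in> V" using that S1_V unfolding E_def by auto
      then show ?thesis unfolding u'_def using u(2) by (simp only: a_simps(3)[OF uV] mult_zero_right)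
    qed
    then have "f u' = (SUP v\<in>E. 0)" unfolding f_def by (intro SUP_cong) simp_all
    also have "\<dots> = 0" using e by (intro cSUP_const) blast
    finally show ?thesis .
  qed
  moreover have "inf_sup nrm a S1 S2 = (INF x\<in>{x\<in>S2. nrm x = 1}. f x)"
    unfolding inf_sup_def f_def E_def ..
  ultimately show False using inf_sup_pos by linarith
qed

lemma P_expansion:
  "\<exists>B d. finite B \<and> B \<subseteq> S2 \<and> (\<forall>b\<in>B. d b \<in> S1) \<and> (\<forall>v\<in>V. P v = (\<Sum>b\<in>B. a b v *\<^sub>C d b)) \<and>
    (\<forall>v\<in>V. \<forall>p. P v = p \<longleftrightarrow> p \<in> S1 \<and> (\<forall>u\<in>S2. a u (v - p) = 0))"
proof -
  obtain B d where B: "finite B" "B \<subseteq> S2" "\<forall>b\<in>B. d b \<in> S1" and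
    iff: "\<forall>v\<in>V. \<forall>p. p \<in> S1 \<and> (\<forall>u\<in>S2. a u (v - p) = 0) \<longleftrightarrow> p = (\<Sum>b\<in>B. a b v *\<^sub>C d b)"
    using oblique_projection_expansion[OF a subspace_V S1_V S2_V dim(1,2) nondegenerate]
    by (elim exE conjE) (rule that)
  have P: "P v = (\<Sum>b\<in>B. a b v *\<^sub>C d b)" if "v \<in> V" for v
    unfolding oblique_projection_def iff[rule_format, OF that] by simp
  show ?thesis
  proof (intro exI[of _ B] exI[of _ d] conjI B ballI allI)
    fix v p assume v: "v \<in> V"
    show "P v = (\<Sum>b\<in>B. a b v *\<^sub>C d b)" by (rule P[OF v])
    show "P v = p \<longleftrightarrow> p \<in> S1 \<and> (\<forall>u\<in>S2. a u (v - p) = 0)"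
      unfolding iff[rule_format, OF v] P[OF v] by auto
  qed
qed

lemma P_eq_iff: "v \<in> V \<Longrightarrow> P v = p \<longleftrightarrow> p \<in> S1 \<and> (\<forall>u\<in>S2. a u (v - p) = 0)"
  using P_expansion by blast

lemma P_in_S1: "v \<in> V \<Longrightarrow> P v \<in> S1" and P_orthogonal: "v \<in> V \<Longrightarrow> u \<in> S2 \<Longrightarrow> a u (v - P v) = 0"
  using P_eq_iff[of v "P v"] by auto

lemma P_in_V: "v \<in> V \<Longrightarrow> P v \<in> V" using P_in_S1 S1_V by blast

lemma P_id: "v \<in> S1 \<Longrightarrow> P v = v"
  using P_eq_iff[of v v] S1_V S2_V a_zero by auto

lemma P_add:
  assumes "x \<in> V" "y \<in> V" shows "P (x + y) = P x + P y"
proof (subst P_eq_iff)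
  have "a u (x + y - (P x + P y)) = 0" if "u \<in> S2" for u
  proof -
    have "a u (x + y - (P x + P y)) = a u ((x - P x) + (y - P y))" by (simp add: algebra_simps)
    also have "\<dots> = 0"
      using assms that S2_V P_orthogonal V_closed P_in_V by (auto simp: a_simps subset_iff)
    finally show ?thesis .
  qed
  then show "P x + P y \<in> S1 \<and> (\<forall>u\<in>S2. a u (x + y - (P x + P y)) = 0)"
    using P_in_S1 assms S1_closed by auto
qed (use assms V_closed in auto)

lemma P_scale:
  assumes "x \<in> V" shows "P (c *\<^sub>C x) = c *\<^sub>C P x"
proof (subst P_eq_iff)
  have "a u (c *\<^sub>C x - c *\<^sub>C P x) = 0" if "u \<in> S2" for u
  proof -
    have "a u (c *\<^sub>C x - c *\<^sub>C P x) = a u (c *\<^sub>C (x - P x))"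
      by (simp add: complex_vector.scale_right_diff_distrib)
    also have "\<dots> = 0"
      using assms that S2_V P_orthogonal V_closed P_in_V by (auto simp: a_simps subset_iff)
    finally show ?thesis .
  qed
  then show "c *\<^sub>C P x \<in> S1 \<and> (\<forall>u\<in>S2. a u (c *\<^sub>C x - c *\<^sub>C P x) = 0)"
    using P_in_S1 assms S1_closed by auto
qed (use assms V_closed in auto)

lemma P_0: "P 0 = 0" using P_id S1_closed(1) by blast

lemma P_diff: "x \<in> V \<Longrightarrow> y \<in> V \<Longrightarrow> P (x - y) = P x - P y"
  using P_add[of "x - y" y] V_closed(3) by simp

lemma P_sum:
  "(\<And>i. i \<in> I \<Longrightarrow> g i \<in> V) \<Longrightarrow> P (\<Sum>i\<in>I. c i *\<^sub>C g i) = (\<Sum>i\<in>I. c i *\<^sub>C P (g i))"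
proof (induction I rule: infinite_finite_induct)
  case (insert i I)
  have "(\<Sum>i\<in>I. c i *\<^sub>C g i) \<in> V"
    using insert.prems V_closed subspace_V by (intro complex_vector.subspace_sum) auto
  then show ?case using insert V_closed by (simp add: P_add P_scale)
qed (simp_all add: P_0)

lemma P_bounded: obtains C where "C \<ge> 0" "\<And>v. v \<in> V \<Longrightarrow> nrm (P v) \<le> C * nrm v"
proof -
  obtain B d where "finite B" and BS: "B \<subseteq> S2" "\<forall>b\<in>B. d b \<in> S1"
    and P: "\<forall>v\<in>V. P v = (\<Sum>b\<in>B. a b v *\<^sub>C d b)"
    using P_expansion by (elim exE conjE) (rule that)
  have B: "b \<in> V" "d b \<in> V" if "b \<in> B" for b using BS S1_V S2_V that by auto
  obtain C where C: "C > 0" "\<And>u v. u \<in> V \<Longrightarrow> v \<in> V \<Longrightarrow> cmod (a u v) \<le> C * nrm u * nrm v"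
    using a_bounded by metis
  show ?thesis
  proof
    show "0 \<le> (\<Sum>b\<in>B. C * nrm b * nrm (d b))"
      using B C(1) by (intro sum_nonneg mult_nonneg_nonneg nrm_nonneg) auto
    fix v assume v: "v \<in> V"
    have "nrm (P v) \<le> (\<Sum>b\<in>B. (C * nrm b * nrm v) * nrm (d b))"
      unfolding P[rule_format, OF v] by (intro nrm_sum_scale C(2) B v)
    also have "\<dots> = (\<Sum>b\<in>B. C * nrm b * nrm (d b)) * nrm v"
      by (simp add: sum_distrib_left sum_distrib_right mult_ac)
    finally show "nrm (P v) \<le> (\<Sum>b\<in>B. C * nrm b * nrm (d b)) * nrm v" .
  qed
qed

lemma Th_eq: "Th x = P (T (P x))" by (simp add: discrete_inv_def)

lemma Th_on_S1:
  "x \<in> S1 \<Longrightarrow> y \<in> S1 \<Longrightarrow> Th (x + y) = Th x + Th y"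
  "x \<in> S1 \<Longrightarrow> Th (c *\<^sub>C x) = c *\<^sub>C Th x"
  "x \<in> S1 \<Longrightarrow> Th x \<in> S1" "Th 0 = 0"
  using S1_V T_in_V by (auto simp: Th_eq P_id P_in_S1 P_0 T_0 T_add T_scale P_add P_scale S1_closed subset_iff)

text \<open>The quotients in the definition of \<open>\<epsilon>\<^sub>V\<close> are bounded, since
  \<open>u - P u = (1 - P) (u - \<Pi> u)\<close> and the operators \<open>P\<close> and \<open>T\<close> are bounded on \<open>V\<close>; therefore their supremum
  is an upper bound. The same identity shows that the numerator vanishes when the denominator does.\<close>

lemma consistency_error_bound:
  assumes U: "U \<subseteq> V" and u: "u \<in> U"
  shows "nrm (P (T (u - P u))) \<le> eps_V V a ip S1 S2 U * nrm (u - orth_projection ip S1 u)"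
    and "0 \<le> eps_V V a ip S1 S2 U"
proof -
  define \<pi> where "\<pi> u = orth_projection ip S1 u" for u
  have \<pi>: "\<pi> u \<in> S1" "u - \<pi> u \<in> V" if "u \<in> V" for u
    using orth_projection_best(1)[OF S1_V dim(1) that] V_closed(3)[OF that] S1_V unfolding \<pi>_def by auto
  obtain C where C: "C \<ge> 0" "\<And>v. v \<in> V \<Longrightarrow> nrm (P v) \<le> C * nrm v" using P_bounded by blast
  obtain \<tau> where \<tau>: "\<tau> > 0" "\<And>v. v \<in> V \<Longrightarrow> nrm (T v) \<le> \<tau> * nrm v" using T_bounded_nrm by blast
  have bound: "nrm (P (T (u - P u))) \<le> (C * (\<tau> * (1 + C))) * nrm (u - \<pi> u)" if u: "u \<in> V" for u
  proof -
    let ?e = "u - \<pi> u"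
    have eV: "?e \<in> V" using \<pi> u by blast
    have split: "u - P u = ?e - P ?e"
      using \<pi>(1)[OF u] u S1_V by (simp add: P_diff P_id subset_iff)
    have "nrm (u - P u) \<le> nrm ?e + nrm (P ?e)"
      unfolding split by (rule nrm_triangle_diff[OF eV P_in_V[OF eV]])
    then have "nrm (u - P u) \<le> (1 + C) * nrm ?e" using C(2)[OF eV] by (simp add: algebra_simps)
    then have "\<tau> * nrm (u - P u) \<le> \<tau> * ((1 + C) * nrm ?e)" using \<tau>(1) by (intro mult_left_mono) auto
    then have "nrm (T (u - P u)) \<le> \<tau> * ((1 + C) * nrm ?e)"
      using \<tau>(2)[of "u - P u"] u V_closed P_in_V by fastforce
    then have "C * nrm (T (u - P u)) \<le> C * (\<tau> * ((1 + C) * nrm ?e))" using C(1) by (intro mult_left_mono) auto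
    then show ?thesis using C(2)[OF T_in_V[of "u - P u"]] by (simp add: mult.assoc)
  qed
  define q where "q u = nrm (P (T (u - P u))) / nrm (u - \<pi> u)" for u
  have "q u \<le> C * (\<tau> * (1 + C))" if "u \<in> U" for u
  proof (cases "nrm (u - \<pi> u) = 0")
    case True
    then show ?thesis unfolding q_def using C(1) \<tau>(1) by simp
  next
    case False
    then have "nrm (u - \<pi> u) > 0" using nrm_nonneg[OF \<pi>(2), of u] that U by fastforce
    then show ?thesis unfolding q_def using bound[of u] that U by (auto simp: field_simps)
  qed
  then have "bdd_above (q ` U)" by (rule bdd_aboveI2)
  from cSUP_upper[OF u this] have le: "q u \<le> eps_V V a ip S1 S2 U"
    unfolding eps_V_def q_def \<pi>_def .
  have uV: "u \<in> V" using u U by blast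
  have "0 \<le> q u"
    unfolding q_def using nrm_nonneg[OF P_in_V[OF T_in_V]] nrm_nonneg[OF \<pi>(2)[OF uV]]
    by (rule divide_nonneg_nonneg)
  then show "0 \<le> eps_V V a ip S1 S2 U" using le by linarith
  show "nrm (P (T (u - P u))) \<le> eps_V V a ip S1 S2 U * nrm (u - orth_projection ip S1 u)"
  proof (cases "nrm (u - \<pi> u) = 0")
    case True
    then have "nrm (P (T (u - P u))) \<le> 0" using bound[OF uV] by simp
    then show ?thesis using True by (simp add: \<pi>_def)
  next
    case False
    then have "nrm (u - \<pi> u) > 0" using nrm_nonneg[OF \<pi>(2)[OF uV]] by linarith
    then show ?thesis using le unfolding q_def \<pi>_def by (simp add: field_simps)
  qed
qed

text \<open>On the finite-dimensional space \<open>S1\<close> the lower bound already gives bijectivity. The spectrum refers to the ambient norm,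
  so the bound is transferred by the equivalence of norms on \<open>S1\<close>.\<close>

lemma discrete_resolvent:
  assumes "C > 0" and stab: "\<And>x. x \<in> S1 \<Longrightarrow> nrm x \<le> C * nrm (z *\<^sub>C x - Th x)"
  shows "z \<notin> op_spectrum S1 S1 Th"
    "y \<in> S1 \<Longrightarrow> resolvent S1 Th z y \<in> S1"
    "y \<in> S1 \<Longrightarrow> z *\<^sub>C resolvent S1 Th z y - Th (resolvent S1 Th z y) = y"
proof -
  have bij: "bij_betw (\<lambda>x. z *\<^sub>C x - Th x) S1 S1"
  proof (rule injective_linear_surjective_on[OF dim(1)])
    show "z *\<^sub>C (x + y) - Th (x + y) = z *\<^sub>C x - Th x + (z *\<^sub>C y - Th y)" if "x \<in> S1" "y \<in> S1" for x y
      using that by (simp add: Th_on_S1 complex_vector.scale_right_distrib)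
    show "z *\<^sub>C c *\<^sub>C x - Th (c *\<^sub>C x) = c *\<^sub>C (z *\<^sub>C x - Th x)" if "x \<in> S1" for c x
      using that by (simp add: Th_on_S1 complex_vector.scale_right_diff_distrib mult.commute)
    show "z *\<^sub>C x - Th x \<in> S1" if "x \<in> S1" for x
      using that by (simp add: Th_on_S1 S1_closed)
    show "x = 0" if "x \<in> S1" "z *\<^sub>C x - Th x = 0" for x
      using stab[OF that(1)] that nrm_0 nrm_eq_0[of x] nrm_nonneg[of x] S1_V by auto
  qed
  obtain c where c: "c > 0" "\<And>v. v \<in> V \<Longrightarrow> norm v \<le> c * nrm v" using norm_le_nrm by blast
  obtain e where e: "\<And>x. x \<in> S1 \<Longrightarrow> nrm x \<le> e * norm x"
    using finite_dimensional_norm_bound[OF S1_V dim(1)] by blast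
  have "norm x \<le> (c * C * e) * norm (z *\<^sub>C x - Th x)" if x: "x \<in> S1" for x
  proof -
    have "z *\<^sub>C x - Th x \<in> S1" using x by (simp add: Th_on_S1 S1_closed)
    from e[OF this] have "C * nrm (z *\<^sub>C x - Th x) \<le> C * (e * norm (z *\<^sub>C x - Th x))"
      using \<open>C > 0\<close> by (intro mult_left_mono) auto
    then have "nrm x \<le> C * (e * norm (z *\<^sub>C x - Th x))" using stab[OF x] by linarith
    then have "c * nrm x \<le> c * (C * (e * norm (z *\<^sub>C x - Th x)))" using c(1) by (intro mult_left_mono) auto
    then show ?thesis using c(2)[of x] x S1_V by (auto simp: mult.assoc)
  qed
  then show "z \<notin> op_spectrum S1 S1 Th" unfolding op_spectrum_def using bij by blast
  show "y \<in> S1 \<Longrightarrow> resolvent S1 Th z y \<in> S1"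
    unfolding resolvent_def using bij bij_betwE bij_betw_the_inv_into by blast
  show "y \<in> S1 \<Longrightarrow> z *\<^sub>C resolvent S1 Th z y - Th (resolvent S1 Th z y) = y"
    unfolding resolvent_def using f_the_inv_into_f_bij_betw[OF bij] by blast
qed

text \<open>The resolvent identity \<open>R(z) y - R(z') y = (z' - z) R(z) R(z') y\<close> makes the map Lipschitz.\<close>

lemma discrete_resolvent_continuous:
  assumes "C > 0" and stab: "\<And>z x. z \<in> Z \<Longrightarrow> x \<in> S1 \<Longrightarrow> nrm x \<le> C * nrm (z *\<^sub>C x - Th x)"
    and y: "y \<in> S1"
  shows "continuous_on Z (\<lambda>z. resolvent S1 Th z y)"
proof -
  obtain c where c: "c > 0" "\<And>v. v \<in> V \<Longrightarrow> norm v \<le> c * nrm v" using norm_le_nrm by blast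
  let ?R = "\<lambda>z. resolvent S1 Th z y"
  have R: "?R z \<in> S1" "z *\<^sub>C ?R z - Th (?R z) = y" if "z \<in> Z" for z
    using discrete_resolvent(2,3)[OF \<open>C > 0\<close> stab[OF that] y] by auto
  have nR: "nrm (?R z) \<le> C * nrm y" if "z \<in> Z" for z
    using stab[OF that R(1)[OF that]] R(2)[OF that] by simp
  have "norm (?R z - ?R z') \<le> (c * C * C * nrm y) * cmod (z - z')" if z: "z \<in> Z" and z': "z' \<in> Z" for z z'
  proof -
    have Th_diff: "Th (?R z - ?R z') = Th (?R z) - Th (?R z')"
      using Th_on_S1(1)[of "?R z - ?R z'" "?R z'"] R(1) z z' S1_closed(3) by simp
    have "z *\<^sub>C (?R z - ?R z') - Th (?R z - ?R z')
        = (z *\<^sub>C ?R z - Th (?R z)) - (z' *\<^sub>C ?R z' - Th (?R z')) + (z' - z) *\<^sub>C ?R z'"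
      unfolding Th_diff
      by (simp add: complex_vector.scale_right_diff_distrib complex_vector.scale_left_diff_distrib)
    also have "\<dots> = (z' - z) *\<^sub>C ?R z'" using R(2) z z' by simp
    finally have "nrm (?R z - ?R z') \<le> C * (cmod (z' - z) * nrm (?R z'))"
      using stab[OF z S1_closed(3)[OF R(1)[OF z] R(1)[OF z']]] nrm_scale[of "?R z'"] R(1)[OF z'] S1_V by auto
    also have "\<dots> \<le> C * (cmod (z' - z) * (C * nrm y))"
      using nR[OF z'] \<open>C > 0\<close> by (intro mult_left_mono) auto
    finally have "c * nrm (?R z - ?R z') \<le> c * (C * (cmod (z' - z) * (C * nrm y)))"
      using c(1) by (intro mult_left_mono) auto
    then show ?thesis
      using c(2)[of "?R z - ?R z'"] S1_closed(3)[OF R(1)[OF z] R(1)[OF z']] S1_V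
      by (auto simp: mult_ac norm_minus_commute)
  qed
  moreover have "0 \<le> c * C * C * nrm y" using c(1) \<open>C > 0\<close> nrm_nonneg y S1_V by auto
  ultimately have "(c * C * C * nrm y)-lipschitz_on Z ?R"
    by (auto intro!: lipschitz_onI simp: dist_norm)
  then show ?thesis by (rule lipschitz_on_continuous_on)
qed

section \<open>The error estimate\<close>

text \<open>This is where the consistency error \<open>P T (1 - P)\<close> enters: the projection of an exact solution solves
  the discrete resolvent equation up to that error.\<close>

lemma galerkin_resolvent_identity:
  assumes w: "w \<in> V"
  shows "z *\<^sub>C P w - Th (P w) = P (z *\<^sub>C w - T w) + P (T (w - P w))"
proof -
  have "Th (P w) = P (T (P w))" using w by (simp add: Th_eq P_id P_in_S1)
  moreover have "P (z *\<^sub>C w - T w) = z *\<^sub>C P w - P (T w)"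
    using w V_closed T_in_V by (simp add: P_diff P_scale)
  moreover have "P (T (w - P w)) = P (T w) - P (T (P w))"
    using T_in_V by (simp add: T_diff P_diff)
  ultimately show ?thesis by simp
qed

text \<open>The difference between \<open>P u\<close> and its discrete Riesz projection is the circle integral of \<open>P w(z) - (z - Th)\<^sup>-\<^sup>1 P u\<close>
  up to the factor \<open>1 / (2 \<pi> \<i>)\<close>, and \<open>z - Th\<close> maps this integrand to the consistency error of \<open>w(z)\<close>. The factor \<open>r\<close> in the constant
  is the length of the circle divided by \<open>2 \<pi>\<close>.\<close>

lemma eigenvector_estimate:
  assumes lam: "lam \<noteq> 0" and r: "r > 0" and C: "C > 0"
    and stab: "\<And>z x. z \<in> sphere (1 / lam) r \<Longrightarrow> x \<in> S1 \<Longrightarrow> nrm x \<le> C * nrm (z *\<^sub>C x - Th x)"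
    and \<kappa>: "\<And>z y. z \<in> sphere (1 / lam) r \<Longrightarrow> y \<in> V \<Longrightarrow> nrm y \<le> \<kappa> * nrm (z *\<^sub>C y - T y)"
    and U: "U = invariant_subspace D A lam" and u: "u \<in> U" "nrm u = 1"
  shows "nrm (riesz_projection S1 Th (1 / lam) r (P u) - P u)
    \<le> r * C * \<kappa> * eps_V V a ip S1 S2 U * subspace_gap nrm U S1"
proof -
  let ?\<mu> = "1 / lam"
  let ?\<gamma> = "circlepath ?\<mu> r"
  let ?d = "\<lambda>t. vector_derivative ?\<gamma> (at t within {0..1})"
  define \<epsilon> where "\<epsilon> = eps_V V a ip S1 S2 U"
  define \<delta> where "\<delta> = subspace_gap nrm U S1"
  have UV: "U \<subseteq> V" using U invariant_subspace_in_V by blast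
  have uV: "u \<in> V" using u UV by blast
  obtain k0 where "(Tshift ?\<mu> ^^ k0) u = 0" using u(1) invariant_subspace_iff[OF lam] U by blast
  \<comment> \<open>A positive exponent guarantees that the sum defining \<open>w\<close> has the term with the simple pole.\<close>
  then obtain k where k: "(Tshift ?\<mu> ^^ Suc k) u = 0"
    by (metis Suc_eq_plus1 Tshift_zero_add(1))
  define w where "w = eigen_resolvent ?\<mu> (Suc k) u"
  have wU: "w z \<in> U" for z
    unfolding w_def U by (rule eigen_resolvent_in_invariant_subspace[OF lam k])
  have wV: "w z \<in> V" for z using wU UV by blast
  have w: "z *\<^sub>C w z - T (w z) = u" if "z \<in> sphere ?\<mu> r" for z
    unfolding w_def using that r by (intro eigen_resolvent_solves k) auto
  have \<epsilon>\<delta>: "0 \<le> \<epsilon>" "0 \<le> \<delta>"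
  proof -
    have "u - orth_projection ip S1 u \<in> V"
      using orth_projection_best(1)[OF S1_V dim(1) uV] uV S1_V V_closed by auto
    then show "0 \<le> \<delta>"
      using distance_le_subspace_gap[OF S1_V dim(1) UV u(1)] nrm_nonneg u(2) unfolding \<delta>_def by fastforce
    show "0 \<le> \<epsilon>" unfolding \<epsilon>_def by (rule consistency_error_bound(2)[OF UV u(1)])
  qed
  have err: "nrm (P (w z) - resolvent S1 Th z (P u)) \<le> C * (\<epsilon> * (\<delta> * \<kappa>))"
    and errS: "P (w z) - resolvent S1 Th z (P u) \<in> S1" if z: "z \<in> sphere ?\<mu> r" for z
  proof -
    let ?R = "resolvent S1 Th z (P u)"
    have R: "?R \<in> S1" "z *\<^sub>C ?R - Th ?R = P u"
      using discrete_resolvent(2,3)[OF C stab[OF z]] P_in_S1[OF uV] by auto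
    show e: "P (w z) - ?R \<in> S1" using P_in_S1[OF wV] R S1_closed(3) by blast
    have Th_diff: "Th (P (w z) - ?R) = Th (P (w z)) - Th ?R"
      using Th_on_S1(1)[OF e R(1)] by simp
    have "z *\<^sub>C (P (w z) - ?R) - Th (P (w z) - ?R) = (z *\<^sub>C P (w z) - Th (P (w z))) - (z *\<^sub>C ?R - Th ?R)"
      unfolding Th_diff by (simp add: complex_vector.scale_right_diff_distrib)
    also have "\<dots> = P (T (w z - P (w z)))"
      unfolding galerkin_resolvent_identity[OF wV] R(2) w[OF z] by simp
    finally have "nrm (P (w z) - ?R) \<le> C * nrm (P (T (w z - P (w z))))" using stab[OF z e] by simp
    also have "nrm (P (T (w z - P (w z)))) \<le> \<epsilon> * nrm (w z - orth_projection ip S1 (w z))"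
      unfolding \<epsilon>_def by (rule consistency_error_bound(1)[OF UV wU])
    also have "nrm (w z - orth_projection ip S1 (w z)) \<le> \<delta> * nrm (w z)"
      unfolding \<delta>_def by (rule distance_le_subspace_gap[OF S1_V dim(1) UV wU])
    also have "nrm (w z) \<le> \<kappa>" using \<kappa>[OF z wV, of z] u(2) unfolding w[OF z] by simp
    finally show "nrm (P (w z) - ?R) \<le> C * (\<epsilon> * (\<delta> * \<kappa>))"
      using C \<epsilon>\<delta> by (auto intro: mult_left_mono)
  qed
  have on_circle: "?\<gamma> t \<in> sphere ?\<mu> r" if "t \<in> {0..1}" for t
    using that r path_image_circlepath_nonneg[of r ?\<mu>] unfolding path_image_def by auto
  have d_eq: "?d t = 2 * of_real pi * \<i> * r * exp (2 * of_real pi * \<i> * t)" if "t \<in> {0..1}" for t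
    using that by (simp add: vector_derivative_circlepath01)
  have d_norm: "cmod (?d t) = 2 * pi * r" if "t \<in> {0..1}" for t
    using r unfolding d_eq[OF that] by (simp add: norm_mult)
  have "continuous_on {0..1} ?d"
    by (rule continuous_on_eq[of _ "\<lambda>t. 2 * of_real pi * \<i> * r * exp (2 * of_real pi * \<i> * of_real t)"])
      (auto intro!: continuous_intros simp: d_eq)
  moreover have "continuous_on {0..1} (\<lambda>t. resolvent S1 Th (?\<gamma> t) (P u))"
  proof (rule continuous_on_compose2[OF discrete_resolvent_continuous[OF C stab P_in_S1[OF uV]]])
    show "continuous_on {0..1} ?\<gamma>" unfolding circlepath by (intro continuous_intros)
    show "?\<gamma> ` {0..1} \<subseteq> sphere ?\<mu> r" using on_circle by blast
  qed auto
  ultimately have "continuous_on {0..1} (\<lambda>t. ?d t *\<^sub>C resolvent S1 Th (?\<gamma> t) (P u))"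
    by (rule continuous_on_scaleC)
  then have F: "((\<lambda>t. ?d t *\<^sub>C resolvent S1 Th (?\<gamma> t) (P u)) has_integral
      vcontour_integral ?\<gamma> (\<lambda>z. resolvent S1 Th z (P u))) {0..1}"
    unfolding vcontour_integral_def using integrable_continuous_interval integrable_integral by blast
  have G: "((\<lambda>t. ?d t *\<^sub>C P (w (?\<gamma> t))) has_integral (2 * of_real pi * \<i>) *\<^sub>C P u) {0..1}"
  proof -
    have SV: "(Tshift ?\<mu> ^^ j) u \<in> V" for j
      by (induction j) (auto simp: Tshift_def uV V_closed T_in_V)
    have "((\<lambda>t. \<Sum>j<Suc k. (?d t * (1 / (?\<gamma> t - ?\<mu>) ^ Suc j)) *\<^sub>C P ((Tshift ?\<mu> ^^ j) u)) has_integral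
        (\<Sum>j<Suc k. (if j = 0 then 2 * of_real pi * \<i> else 0) *\<^sub>C P ((Tshift ?\<mu> ^^ j) u))) {0..1}"
      by (intro has_integral_sum finite_lessThan
          has_integral_linear[OF has_integral_circlepath_power[OF r] bounded_linear_scaleC_left, unfolded comp_def])
    moreover have "(\<Sum>j<Suc k. (if j = 0 then 2 * of_real pi * \<i> else 0) *\<^sub>C P ((Tshift ?\<mu> ^^ j) u))
        = (2 * of_real pi * \<i>) *\<^sub>C P u"
      by (simp add: sum.lessThan_Suc_shift del: sum.lessThan_Suc)
    moreover have "?d t *\<^sub>C P (w (?\<gamma> t))
        = (\<Sum>j<Suc k. (?d t * (1 / (?\<gamma> t - ?\<mu>) ^ Suc j)) *\<^sub>C P ((Tshift ?\<mu> ^^ j) u))" for t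
      unfolding w_def eigen_resolvent_def P_sum[OF SV]
      by (simp only: complex_vector.scale_sum_right complex_vector.scale_scale)
    ultimately show ?thesis by simp
  qed
  define I where "I = (2 * of_real pi * \<i>) *\<^sub>C P u - vcontour_integral ?\<gamma> (\<lambda>z. resolvent S1 Th z (P u))"
  have eq: "?d t *\<^sub>C P (w (?\<gamma> t)) - ?d t *\<^sub>C resolvent S1 Th (?\<gamma> t) (P u)
      = ?d t *\<^sub>C (P (w (?\<gamma> t)) - resolvent S1 Th (?\<gamma> t) (P u))" for t
    by (simp add: complex_vector.scale_right_diff_distrib)
  have I_integral: "((\<lambda>t. ?d t *\<^sub>C (P (w (?\<gamma> t)) - resolvent S1 Th (?\<gamma> t) (P u))) has_integral I) {0..1}"
    using has_integral_diff[OF G F] unfolding eq I_def .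
  have in_S1: "?d t *\<^sub>C (P (w (?\<gamma> t)) - resolvent S1 Th (?\<gamma> t) (P u)) \<in> S1" if "t \<in> {0..1}" for t
    using errS[OF on_circle[OF that]] by (rule S1_closed(4))
  have bound: "nrm (?d t *\<^sub>C (P (w (?\<gamma> t)) - resolvent S1 Th (?\<gamma> t) (P u)))
      \<le> 2 * pi * r * (C * (\<epsilon> * (\<delta> * \<kappa>)))" if t: "t \<in> {0..1}" for t
  proof -
    have "nrm (?d t *\<^sub>C (P (w (?\<gamma> t)) - resolvent S1 Th (?\<gamma> t) (P u)))
        = 2 * pi * r * nrm (P (w (?\<gamma> t)) - resolvent S1 Th (?\<gamma> t) (P u))"
      using nrm_scale errS[OF on_circle[OF t]] S1_V d_norm[OF t] by auto
    also have "\<dots> \<le> 2 * pi * r * (C * (\<epsilon> * (\<delta> * \<kappa>)))"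
      using err[OF on_circle[OF t]] r by (intro mult_left_mono) auto
    finally show ?thesis .
  qed
  have I: "I \<in> S1" "nrm I \<le> 2 * pi * r * (C * (\<epsilon> * (\<delta> * \<kappa>)))"
    by (rule integral_in_finite_dimensional_subspace[OF S1_V dim(1) I_integral in_S1 bound]; assumption)+
  let ?c = "1 / (2 * of_real pi * \<i>) :: complex"
  have "riesz_projection S1 Th ?\<mu> r (P u) - P u = (- ?c) *\<^sub>C I"
    unfolding riesz_projection_def I_def complex_vector.scale_right_diff_distrib complex_vector.scale_scale
    by simp
  then have "nrm (riesz_projection S1 Th ?\<mu> r (P u) - P u) = nrm I / (2 * pi)"
    using nrm_scale[of I "- ?c"] I S1_V by (auto simp: norm_divide norm_mult)
  also have "\<dots> \<le> (2 * pi * r * (C * (\<epsilon> * (\<delta> * \<kappa>)))) / (2 * pi)"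
    using I by (intro divide_right_mono) auto
  also have "\<dots> = r * C * \<kappa> * \<epsilon> * \<delta>" by simp
  finally show ?thesis unfolding \<epsilon>_def \<delta>_def .
qed

end

theorem theorem5p1:
  fixes V :: "'h::chilbert_space set"
    and a ip :: "'h \<Rightarrow> 'h \<Rightarrow> complex"
    and \<alpha> M r :: real
    and lam :: complex
    and m :: nat
    and S1 S2 :: "real \<Rightarrow> 'h set"
    and N :: "real \<Rightarrow> nat"
    and U :: "'h set"
  assumes separable: "\<exists>D::'h set. countable D \<and> closure D = UNIV"
    and \<alpha>M: "\<alpha> > 0" "M > 0"
    and form: "closed_sectorial_form V a \<alpha> M"
    and V_hilbert: "hilbert_on V ip" "equivalent_ip_on V ip (form_real_part a)"
    and eigenvalue: "lam \<noteq> 0" "isolated_eigenvalue (form_dom V a) (form_op V a) lam m"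
    and U: "U = invariant_subspace (form_dom V a) (form_op V a) lam"
    and circle: "r > 0" "0 \<notin> cball (1 / lam) r"
      "\<And>z. z \<in> op_spectrum UNIV UNIV (form_inv V a) \<Longrightarrow> z \<noteq> 1 / lam \<Longrightarrow> z \<notin> cball (1 / lam) r"
    and trial_spaces: "\<And>h. h > 0 \<Longrightarrow> S1 h \<subseteq> V \<and> S2 h \<subseteq> V"
      "\<And>h. h > 0 \<Longrightarrow> N h \<ge> 1 \<and> has_cdim (S1 h) (N h) \<and> has_cdim (S2 h) (N h)"
    and inf_sup: "\<And>h. h > 0 \<Longrightarrow> inf_sup (ipnorm ip) a (S1 h) (S2 h) > 0"
      "\<And>h. h > 0 \<Longrightarrow> inf_sup norm cinner (S1 h) (S2 h) > 0"
    and approximation: "\<And>v. v \<in> V \<Longrightarrow>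
      ((\<lambda>h. inverse (inf_sup (ipnorm ip) a (S1 h) (S2 h)) * set_dist (ipnorm ip) v (S1 h)) \<longlongrightarrow> 0)
        (at_right 0)"
    and gap_convergence:
      "((\<lambda>h. operator_gap (ipnorm ip) (S1 h) (discrete_inv V a (S1 h) (S2 h)) V (form_inv V a)) \<longlongrightarrow> 0)
        (at_right 0)"
  shows "\<exists>h0>0. \<exists>c>0. \<forall>h. 0 < h \<and> h < h0 \<longrightarrow>
    sphere (1 / lam) r \<inter> op_spectrum (S1 h) (S1 h) (discrete_inv V a (S1 h) (S2 h)) = {} \<and>
    (\<forall>u\<in>U. ipnorm ip u = 1 \<longrightarrow>
      (\<exists>u_h \<in> riesz_projection (S1 h) (discrete_inv V a (S1 h) (S2 h)) (1 / lam) r ` S1 h.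
         ipnorm ip (u_h - oblique_projection a (S1 h) (S2 h) u)
           \<le> c * eps_V V a ip (S1 h) (S2 h) U * subspace_gap (ipnorm ip) U (S1 h)))"
proof -
  interpret sectorial_form V ip a \<alpha> M
    using V_hilbert form \<alpha>M
    by unfold_locales (auto simp: hilbert_on_def)
  define Z where "Z = sphere (1 / lam) r"
  have "z \<notin> op_spectrum UNIV UNIV T" if "z \<in> Z" for z
    using circle(1) circle(3)[of z] that unfolding Z_def by auto
  then have Z: "compact Z" "Z \<inter> op_spectrum UNIV UNIV T = {}" "0 \<notin> Z"
    using circle(2) unfolding Z_def by auto
  obtain \<kappa> where \<kappa>: "\<kappa> > 0" "\<And>z y. z \<in> Z \<Longrightarrow> y \<in> V \<Longrightarrow> nrm y \<le> \<kappa> * nrm (z *\<^sub>C y - T y)"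
    using resolvent_bound_nrm[OF Z] by metis
  obtain \<delta> C where \<delta>: "\<delta> > 0" and C: "C > 0"
    and stab: "\<And>S L z x. S \<subseteq> V \<Longrightarrow> L ` S \<subseteq> V \<Longrightarrow> L 0 = 0 \<Longrightarrow> operator_gap nrm S L V T < \<delta> \<Longrightarrow>
      z \<in> Z \<Longrightarrow> x \<in> S \<Longrightarrow> nrm x \<le> C * nrm (z *\<^sub>C x - L x)"
    by (rule discrete_stability[OF Z]) blast
  have "\<forall>\<^sub>F h in at_right 0. operator_gap nrm (S1 h) (discrete_inv V a (S1 h) (S2 h)) V T < \<delta>"
    using order_tendstoD(2)[OF gap_convergence \<delta>] .
  then obtain h0 where h0: "h0 > 0"
    "\<And>h. 0 < h \<Longrightarrow> h < h0 \<Longrightarrow> operator_gap nrm (S1 h) (discrete_inv V a (S1 h) (S2 h)) V T < \<delta>"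
    unfolding eventually_at_right_field by auto
  show ?thesis
  proof (rule exI[of _ h0], rule conjI[OF h0(1)], rule exI[of _ "r * C * \<kappa>"], intro conjI allI impI ballI)
    show "r * C * \<kappa> > 0" using circle(1) C \<kappa>(1) by simp
    fix h assume h: "0 < h \<and> h < h0"
    interpret petrov_galerkin V ip a \<alpha> M "S1 h" "S2 h" "N h"
      using trial_spaces[of h] inf_sup(1)[of h] h by unfold_locales auto
    have stab_h: "nrm x \<le> C * nrm (z *\<^sub>C x - Th x)" if "z \<in> Z" "x \<in> S1 h" for z x
      using that h h0(2)[of h] S1_V Th_on_S1(3,4) by (intro stab[of "S1 h" Th z x]) auto
    show "sphere (1 / lam) r \<inter> op_spectrum (S1 h) (S1 h) Th = {}"
      using discrete_resolvent(1)[OF C stab_h] unfolding Z_def by blast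
    fix u assume u: "u \<in> U" "nrm u = 1"
    have uV: "u \<in> V" using u(1) U invariant_subspace_in_V by blast
    have "nrm (riesz_projection (S1 h) Th (1 / lam) r (P u) - P u)
        \<le> r * C * \<kappa> * eps_V V a ip (S1 h) (S2 h) U * subspace_gap nrm U (S1 h)"
      using eigenvalue(1) circle(1) C stab_h \<kappa>(2) U u unfolding Z_def by (rule eigenvector_estimate)
    then show "\<exists>u_h \<in> riesz_projection (S1 h) Th (1 / lam) r ` S1 h.
        nrm (u_h - P u) \<le> r * C * \<kappa> * eps_V V a ip (S1 h) (S2 h) U * subspace_gap nrm U (S1 h)"
      using P_in_S1[OF uV] by blast
  qed
qed

end
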